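(* Let $M\subseteq K$ be a separable (not necessarily algebraic) extension of fields of characteristic $p>0$, and let $m>0$ be an integer. Let $\partial=(\partial_i)_{i<p^m}$ be a $\mathbb{G}_{\rm a}[m]$-derivation on $K$ over $M$. Then $\partial$ can be expanded to a $\mathbb{G}_{\rm a}$-derivation on $K$ over $M$; that is, there is a $\mathbb{G}_{\rm a}$-derivation $D=(D_i)_{i\in\mathbb{N}}$ on $K$ over $M$ with $D_i=\partial_i$ for all $i<p^m$.
   Context: A $\mathbb{G}_{\rm a}$-derivation on $K$ (an iterative HS-derivation) is a sequence $D=(D_n:K\to K)_{n\in\mathbb{N}}$ of additive maps with $D_0=\mathrm{id}$, $D_n(xy)=\sum_{i+j=n}D_i(x)D_j(y)$ for all $n\in\mathbb{N}$ and $x,y\in K$, and $D_i\circ D_j=\binom{i+j}{i}D_{i+j}$ for all $i,j\in\mathbb{N}$. A $\mathbb{G}_{\rm a}[m]$-derivation on $K$ (an iterative $m$-truncated HS-derivation) is a sequence $\partial=(\partial_n:K\to K)_{n<p^m}$ of additive maps with $\partial_0=\mathrm{id}$, $\partial_n(xy)=\sum_{i+j=n}\partial_i(x)\partial_j(y)$ for all $n<p^m$ and $x,y\in K$, and $\partial_i\circ\partial_j=\binom{i+j}{i}\partial_{i+j}$ for all $i,j<p^m$ (for $i+j\ge p^m$ the binomial coefficient is $0$ modulo $p$ and the right side is read as $0$). In both cases "over $M$" means that all terms with index $n>0$ vanish on $M$. *)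

theory Defs
  imports "HOL-Algebra.Algebraic_Closure_Type"
begin

text \<open>
  The big field \<open>K\<close> is a type of class \<^class>\<open>field\<close>; the base field \<open>M\<close> is a subset of it.
\<close>

definition is_subfield :: "'a::field set \<Rightarrow> bool" where
  "is_subfield M \<longleftrightarrow> 0 \<in> M \<and> 1 \<in> M \<and>
     (\<forall>x\<in>M. \<forall>y\<in>M. x - y \<in> M \<and> x * y \<in> M) \<and> (\<forall>x\<in>M. inverse x \<in> M)"

definition lin_indep_over :: "'a::field set \<Rightarrow> 'a set \<Rightarrow> bool" where
  "lin_indep_over F B \<longleftrightarrow>
     (\<forall>A c. finite A \<and> A \<subseteq> B \<and> (\<forall>b\<in>A. c b \<in> F) \<and> (\<Sum>b\<in>A. c b * b) = 0 \<longrightarrow> (\<forall>b\<in>A. c b = 0))"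

text \<open>
  \<open>E\<close> and \<open>L\<close> are linearly disjoint over \<open>F\<close>, for fields \<open>F \<subseteq> E\<close> and \<open>F \<subseteq> L\<close> inside a common field.
\<close>

definition linearly_disjoint :: "'a::field set \<Rightarrow> 'a set \<Rightarrow> 'a set \<Rightarrow> bool" where
  "linearly_disjoint F E L \<longleftrightarrow> (\<forall>B. B \<subseteq> E \<and> lin_indep_over F B \<longrightarrow> lin_indep_over L B)"

text \<open>
  For \<open>p\<close> the characteristic, the set of all \<open>p\<close>-power roots of elements of \<open>M\<close>,
  i.e. \<open>M\<close> with exponent \<open>1/p\<^sup>\<infinity>\<close> (the perfect closure of \<open>M\<close>), formed in the algebraic closure of \<open>K\<close>.
\<close>

definition perfect_closure :: "'a::field set \<Rightarrow> 'a alg_closure set" where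
  "perfect_closure M = {y. \<exists>n. y ^ (CHAR('a) ^ n) \<in> to_ac ` M}"

text \<open>
  Separability of a not necessarily algebraic field extension \<open>K / M\<close> in the sense of MacLane, Lang
  and Fried--Jarden: \<open>K\<close> is linearly disjoint over \<open>M\<close> from the perfect closure of \<open>M\<close>. In
  characteristic \<open>0\<close> every extension is separable.
\<close>

definition separable_extension :: "'a::field set \<Rightarrow> bool" where
  "separable_extension M \<longleftrightarrow>
     CHAR('a) = 0 \<or> linearly_disjoint (to_ac ` M) (range to_ac) (perfect_closure M)"

definition Ga_derivation :: "(nat \<Rightarrow> 'a::field \<Rightarrow> 'a) \<Rightarrow> bool" where
  "Ga_derivation D \<longleftrightarrow>
     (\<forall>n. Modules.additive (D n)) \<and>
     D 0 = id \<and>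
     (\<forall>n x y. D n (x * y) = (\<Sum>i\<le>n. D i x * D (n - i) y)) \<and>
     (\<forall>i j x. D i (D j x) = of_nat ((i + j) choose i) * D (i + j) x)"

text \<open>
  A truncated sequence is a function on all of \<^typ>\<open>nat\<close> of which only the terms with index
  below \<open>p ^ m\<close> are constrained.
\<close>

definition truncated_Ga_derivation ::
    "nat \<Rightarrow> nat \<Rightarrow> (nat \<Rightarrow> 'a::field \<Rightarrow> 'a) \<Rightarrow> bool" where
  "truncated_Ga_derivation p m d \<longleftrightarrow>
     (\<forall>n < p ^ m. Modules.additive (d n)) \<and>
     d 0 = id \<and>
     (\<forall>n < p ^ m. \<forall>x y. d n (x * y) = (\<Sum>i\<le>n. d i x * d (n - i) y)) \<and>
     (\<forall>i < p ^ m. \<forall>j < p ^ m. \<forall>x. d i (d j x) =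
        (if i + j < p ^ m then of_nat ((i + j) choose i) * d (i + j) x else 0))"

end

theory Submission
  imports Defs
begin

text \<open>
  By induction on \<open>m\<close>. If \<open>d\<^sub>1 = 0\<close>, only the indices divisible by \<open>p\<close> matter, and
  \<open>n \<mapsto> d\<^sub>p\<^sub>n\<close> is truncated at level \<open>m - 1\<close>. Otherwise there is an \<open>x\<close> with \<open>d\<^sub>1 x = 1\<close> and
  \<open>d\<^sub>i x = 0\<close> for \<open>i > 1\<close>, and \<open>K = C[x]\<close> is purely inseparable of degree \<open>p\<^sup>m\<close> over the
  field \<open>C\<close> of constants, so that \<open>d\<close> consists of the Hasse derivatives in \<open>x\<close> over \<open>C\<close>. It suffices
  to find a decreasing chain of fields \<open>C = C\<^sub>m \<supseteq> C\<^sub>m\<^sub>+\<^sub>1 \<supseteq> \<dots>\<close> containing \<open>M\<close> such that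
  \<open>K = C\<^sub>k[x]\<close> has degree \<open>p\<^sup>k\<close> over \<open>C\<^sub>k\<close>: the Hasse derivatives over the various \<open>C\<^sub>k\<close> are
  compatible. Given \<open>C\<^sub>k\<close>, put \<open>y = x ^ (p ^ k)\<close>. Separability implies that \<open>y\<close> is not
  in the compositum of \<open>M\<close> and \<open>C\<^sub>k\<^sup>p\<close>, and any subfield of \<open>C\<^sub>k\<close> that contains this compositum and
  is maximal among those without \<open>y\<close> can serve as \<open>C\<^sub>k\<^sub>+\<^sub>1\<close>.
\<close>

subsection \<open>Subrings, subfields and polynomials over them\<close>

definition is_subring :: "'a::field set \<Rightarrow> bool" where
  "is_subring R \<longleftrightarrow> 1 \<in> R \<and> (\<forall>x\<in>R. \<forall>y\<in>R. x - y \<in> R \<and> x * y \<in> R)"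

lemma subring_zero: "is_subring R \<Longrightarrow> 0 \<in> R"
  unfolding is_subring_def by (metis diff_self)

lemma subring_one: "is_subring R \<Longrightarrow> 1 \<in> R"
  by (simp add: is_subring_def)

lemma subring_diff: "is_subring R \<Longrightarrow> x \<in> R \<Longrightarrow> y \<in> R \<Longrightarrow> x - y \<in> R"
  by (simp add: is_subring_def)

lemma subring_mult: "is_subring R \<Longrightarrow> x \<in> R \<Longrightarrow> y \<in> R \<Longrightarrow> x * y \<in> R"
  by (simp add: is_subring_def)

lemma subring_uminus: "is_subring R \<Longrightarrow> x \<in> R \<Longrightarrow> - x \<in> R"
  using subring_diff[of R 0 x] by (simp add: subring_zero)

lemma subring_add: "is_subring R \<Longrightarrow> x \<in> R \<Longrightarrow> y \<in> R \<Longrightarrow> x + y \<in> R"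
  using subring_diff[of R x "- y"] by (simp add: subring_uminus)

lemma subring_power: "is_subring R \<Longrightarrow> x \<in> R \<Longrightarrow> x ^ n \<in> R"
  by (induction n) (simp_all add: subring_one subring_mult)

lemma subring_of_nat: "is_subring R \<Longrightarrow> of_nat n \<in> R"
  by (induction n) (simp_all add: subring_zero subring_one subring_add)

lemma subring_sum: "is_subring R \<Longrightarrow> (\<And>i. i \<in> A \<Longrightarrow> f i \<in> R) \<Longrightarrow> sum f A \<in> R"
  by (induction A rule: infinite_finite_induct) (simp_all add: subring_zero subring_add)

lemmas subring_closed = subring_zero subring_one subring_diff subring_mult subring_uminus
  subring_add subring_power subring_of_nat subring_sum

lemma subfield_subring: "is_subfield F \<Longrightarrow> is_subring F"
  by (simp add: is_subfield_def is_subring_def)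

lemma subfield_inverse: "is_subfield F \<Longrightarrow> x \<in> F \<Longrightarrow> inverse x \<in> F"
  by (simp add: is_subfield_def)

lemma subfield_divide: "is_subfield F \<Longrightarrow> x \<in> F \<Longrightarrow> y \<in> F \<Longrightarrow> x / y \<in> F"
  by (simp add: divide_inverse subring_mult subfield_subring subfield_inverse)

text \<open>For nonzero \<open>w\<close> the inverse is
  \<open>w ^ (n - 1) * inverse (w ^ n)\<close>, and \<open>w ^ n\<close> is already inverted inside
  \<open>F\<close>.\<close>

lemma subring_radical_subfield:
  assumes R: "is_subring R" and F: "is_subfield F" and "F \<subseteq> R"
    and n: "n > 0" and pow: "\<And>w. w \<in> R \<Longrightarrow> w ^ n \<in> F"
  shows "is_subfield R"
proof -
  have "inverse w \<in> R" if w: "w \<in> R" for w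
  proof (cases "w = 0")
    case False
    have "inverse w = w ^ (n - 1) * inverse (w ^ n)"
      using False n by (cases n) (simp_all add: field_simps)
    moreover have "inverse (w ^ n) \<in> R"
      using pow[OF w] F \<open>F \<subseteq> R\<close> subfield_inverse by blast
    ultimately show ?thesis
      using R w by (simp add: subring_mult subring_power)
  qed (use R in \<open>simp add: subring_zero\<close>)
  thus ?thesis
    using R by (auto simp: is_subfield_def subring_closed)
qed

section \<open>Polynomials over a subring and adjunction of an element\<close>

definition polys_over :: "'a::field set \<Rightarrow> 'a Polynomial.poly set" where
  "polys_over R = {f. \<forall>i. Polynomial.coeff f i \<in> R}"

definition adjoin :: "'a::field set \<Rightarrow> 'a \<Rightarrow> 'a set" where
  "adjoin R x = (\<lambda>f. poly f x) ` polys_over R"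

lemma polys_over_coeff: "f \<in> polys_over R \<Longrightarrow> Polynomial.coeff f i \<in> R"
  by (simp add: polys_over_def)

lemma polys_over_pCons_iff: "pCons a f \<in> polys_over R \<longleftrightarrow> a \<in> R \<and> f \<in> polys_over R"
  unfolding polys_over_def by (auto simp: coeff_pCons split: nat.splits)

lemma polys_over_0: "is_subring R \<Longrightarrow> 0 \<in> polys_over R"
  by (simp add: polys_over_def subring_zero)

lemma polys_over_const: "is_subring R \<Longrightarrow> a \<in> R \<Longrightarrow> [:a:] \<in> polys_over R"
  by (simp add: polys_over_pCons_iff polys_over_0)

lemma polys_over_diff: "is_subring R \<Longrightarrow> f \<in> polys_over R \<Longrightarrow> g \<in> polys_over R \<Longrightarrow> f - g \<in> polys_over R"
  by (simp add: polys_over_def subring_diff)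

lemma polys_over_add: "is_subring R \<Longrightarrow> f \<in> polys_over R \<Longrightarrow> g \<in> polys_over R \<Longrightarrow> f + g \<in> polys_over R"
  by (simp add: polys_over_def subring_add)

lemma polys_over_mult: "is_subring R \<Longrightarrow> f \<in> polys_over R \<Longrightarrow> g \<in> polys_over R \<Longrightarrow> f * g \<in> polys_over R"
  by (simp add: polys_over_def coeff_mult subring_sum subring_mult)

lemma polys_over_smult: "is_subring R \<Longrightarrow> a \<in> R \<Longrightarrow> f \<in> polys_over R \<Longrightarrow> smult a f \<in> polys_over R"
  by (simp add: polys_over_def subring_mult)

lemma polys_over_monom: "is_subring R \<Longrightarrow> a \<in> R \<Longrightarrow> Polynomial.monom a n \<in> polys_over R"
  by (simp add: polys_over_def subring_zero)

lemma polys_over_mono: "R \<subseteq> S \<Longrightarrow> polys_over R \<subseteq> polys_over S"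
  by (auto simp: polys_over_def)

lemma adjoin_subring:
  assumes R: "is_subring R"
  shows "is_subring (adjoin R x)"
proof -
  have "1 \<in> adjoin R x"
    unfolding adjoin_def by (rule image_eqI[of _ _ "[:1:]"]) (simp_all add: R polys_over_const subring_one)
  moreover have "poly f x - poly g x \<in> adjoin R x \<and> poly f x * poly g x \<in> adjoin R x"
    if "f \<in> polys_over R" "g \<in> polys_over R" for f g
    unfolding adjoin_def poly_diff[symmetric] poly_mult[symmetric]
    using that R by (intro conjI imageI polys_over_diff polys_over_mult)
  ultimately show ?thesis
    unfolding is_subring_def by (auto simp: adjoin_def)
qed

lemma subset_adjoin: "is_subring R \<Longrightarrow> R \<subseteq> adjoin R x"
  unfolding adjoin_def by (force intro: polys_over_const)

lemma mem_adjoin: "is_subring R \<Longrightarrow> x \<in> adjoin R x"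
  unfolding adjoin_def
  by (rule image_eqI[of _ _ "[:0, 1:]"]) (simp_all add: polys_over_pCons_iff subring_closed polys_over_0)

lemma adjoin_least:
  assumes "is_subring S" "R \<subseteq> S" "x \<in> S"
  shows "adjoin R x \<subseteq> S"
proof -
  have "poly f x \<in> S" if "f \<in> polys_over R" for f
    using that assms
    by (induction f) (auto simp: polys_over_pCons_iff subring_closed)
  thus ?thesis by (auto simp: adjoin_def)
qed

text \<open>Frobenius is additive, so the p-th power of \<open>poly f x\<close> is a polynomial
  expression in the p-th power of \<open>x\<close> whose coefficients are p-th powers of elements of
  \<open>R\<close>.\<close>

lemma adjoin_power_mem:
  assumes F: "is_subring F" and p: "prime CHAR('a::field)" and x: "(x::'a) ^ CHAR('a) \<in> F"
    and pow: "\<And>a. a \<in> R \<Longrightarrow> a ^ CHAR('a) \<in> F" and w: "w \<in> adjoin R x"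
  shows "w ^ CHAR('a) \<in> F"
proof -
  have "poly f x ^ CHAR('a) \<in> F" if "f \<in> polys_over R" for f
    using that
    by (induction f)
      (use p in \<open>auto simp: polys_over_pCons_iff freshmans_dream power_mult_distrib power_0_left
          intro!: subring_add[OF F] subring_mult[OF F] x pow subring_zero[OF F]\<close>)
  thus ?thesis using w by (auto simp: adjoin_def)
qed

lemma adjoin_subfield:
  assumes F: "is_subfield F" and p: "prime CHAR('a::field)" and x: "(x::'a) ^ CHAR('a) \<in> F"
  shows "is_subfield (adjoin F x)"
proof (rule subring_radical_subfield[OF adjoin_subring F subset_adjoin])
  show "w ^ CHAR('a) \<in> F" if "w \<in> adjoin F x" for w
    using subfield_subring[OF F] by (rule adjoin_power_mem[OF _ p x _ that])
      (simp add: F subfield_subring subring_power)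
qed (use F p in \<open>auto intro: subfield_subring prime_gt_0_nat\<close>)

section \<open>Powers of X - x, and minimal polynomials of purely inseparable elements\<close>

lemma dvd_linear_power:
  fixes f :: "'a::field Polynomial.poly"
  assumes "f dvd [:-x, 1:] ^ n"
  shows "\<exists>m c. c \<noteq> 0 \<and> f = smult c ([:-x, 1:] ^ m)"
  using assms
proof (induction n arbitrary: f)
  case 0
  then obtain c where "f = [:c:]" "c dvd 1"
    by (auto simp: is_unit_poly_iff)
  moreover from this have "c \<noteq> 0" by auto
  ultimately show ?case by (intro exI[of _ 0] exI[of _ c]) auto
next
  case (Suc n)
  then obtain g where g: "f * g = [:-x, 1:] * [:-x, 1:] ^ n"
    by (metis dvdE power_Suc)
  \<comment> \<open>X - x is prime: one linear factor is cancelled either from \<open>f\<close>,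
    which raises the exponent, or from the cofactor \<open>g\<close>.\<close>
  hence "poly (f * g) x = 0" by simp
  hence "poly f x = 0 \<or> poly g x = 0" by simp
  thus ?case
  proof
    assume "poly f x = 0"
    then obtain h where h: "f = [:-x, 1:] * h" by (auto simp: poly_eq_0_iff_dvd)
    with g have "[:-x, 1:] * (h * g) = [:-x, 1:] * [:-x, 1:] ^ n" by (simp only: mult.assoc)
    hence "h * g = [:-x, 1:] ^ n"
      by (subst (asm) mult_cancel_left) auto
    then obtain m c where "c \<noteq> 0" "h = smult c ([:-x, 1:] ^ m)"
      using Suc.IH[of h] by (metis dvd_triv_left)
    thus ?thesis using h by (intro exI[of _ "Suc m"] exI[of _ c]) auto
  next
    assume "poly g x = 0"
    then obtain h where h: "g = [:-x, 1:] * h" by (auto simp: poly_eq_0_iff_dvd)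
    with g have "[:-x, 1:] * (f * h) = [:-x, 1:] * [:-x, 1:] ^ n"
      by (simp only: mult.assoc mult.left_commute)
    hence "f * h = [:-x, 1:] ^ n"
      by (subst (asm) mult_cancel_left) auto
    thus ?thesis using Suc.IH[of f] by (metis dvd_triv_left)
  qed
qed

text \<open>Frobenius applied to X = (X - x) + x.\<close>

lemma linear_char_power:
  fixes x :: "'a::field"
  assumes "prime CHAR('a)"
  shows "[:-x, 1:] ^ (CHAR('a) ^ s) = Polynomial.monom 1 (CHAR('a) ^ s) - [:x ^ (CHAR('a) ^ s):]"
proof -
  have "[:0, 1:] ^ (CHAR('a) ^ s) = ([:-x, 1:] + [:x:]) ^ (CHAR('a) ^ s)"
    by simp
  also have "\<dots> = [:-x, 1:] ^ (CHAR('a) ^ s) + [:x:] ^ (CHAR('a) ^ s)"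
    by (rule freshmans_dream') (simp_all add: assms)
  finally show ?thesis
    by (simp add: poly_const_pow monom_altdef)
qed

text \<open>
  With \<open>e = q u\<close> for the largest power \<open>q\<close> of \<open>p\<close> dividing \<open>e\<close>, the coefficient of
  \<open>X ^ (q * (u - 1))\<close> in \<open>(X - x) ^ e = (X ^ q - x ^ q) ^ u\<close> is \<open>- u * x ^ q\<close>.
\<close>

lemma linear_power_over_imp_dvd:
  fixes x :: "'a::field"
  assumes C: "is_subring C" and p: "prime CHAR('a)"
    and inC: "[:-x, 1:] ^ e \<in> polys_over C" and e: "e > 0"
    and notin: "\<And>s. s < k \<Longrightarrow> x ^ (CHAR('a) ^ s) \<notin> C"
    and inv: "\<And>n. of_nat n \<noteq> (0::'a) \<Longrightarrow> inverse (of_nat n) \<in> C"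
  shows "CHAR('a) ^ k dvd e"
proof -
  define s u where "s = multiplicity CHAR('a) e" and "u = e div CHAR('a) ^ s"
  define q where "q = CHAR('a) ^ s"
  have eq: "e = q * u"
    by (simp add: q_def u_def s_def multiplicity_dvd)
  have u: "\<not> CHAR('a) dvd u"
    using multiplicity_decompose[of e "CHAR('a)"] e p
    by (simp add: u_def s_def)
  hence "u > 0" by (auto intro: gr0I)
  have q: "q > 0" using p by (simp add: q_def prime_gt_0_nat)
  have qq: "Polynomial.monom 1 q - [:x ^ q:] = Polynomial.monom 1 q + [:- (x ^ q):]"
    by (rule poly_eqI) (simp add: coeff_pCons split: nat.split)
  have "[:-x, 1:] ^ e = (Polynomial.monom 1 q + [:- (x ^ q):]) ^ u"
    by (simp only: eq power_mult linear_char_power[OF p, of x s, folded q_def] qq)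
  also have "\<dots> = (\<Sum>i\<le>u. of_nat (u choose i) * Polynomial.monom 1 q ^ i * [:- (x ^ q):] ^ (u - i))"
    by (rule binomial_ring)
  also have "Polynomial.coeff \<dots> (q * (u - 1)) =
      (\<Sum>i\<le>u. if i = u - 1 then of_nat (u choose i) * (- (x ^ q)) ^ (u - i) else 0)"
    unfolding coeff_sum
  proof (intro sum.cong refl)
    fix i assume "i \<in> {..u}"
    have "of_nat (u choose i) * Polynomial.monom 1 q ^ i * [:- (x ^ q):] ^ (u - i)
       = Polynomial.monom (of_nat (u choose i) * (- (x ^ q)) ^ (u - i)) (q * i)"
      by (simp add: monom_power poly_const_pow of_nat_poly smult_monom mult.commute)
    thus "Polynomial.coeff (of_nat (u choose i) * Polynomial.monom 1 q ^ i * [:- (x ^ q):] ^ (u - i)) (q * (u - 1))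
        = (if i = u - 1 then of_nat (u choose i) * (- (x ^ q)) ^ (u - i) else 0)"
      using q by simp
  qed
  also have "\<dots> = of_nat u * (- (x ^ q))"
    using \<open>u > 0\<close> by (cases u) (simp_all add: sum.delta)
  finally have "of_nat u * (- (x ^ q)) \<in> C"
    using polys_over_coeff[OF inC] by metis
  \<comment> \<open>As p does not divide \<open>u\<close>, it can be inverted, so
    \<open>x ^ q\<close> itself lies in \<open>C\<close>; \<open>notin\<close> then excludes
    \<open>s < k\<close>.\<close>
  hence "- (inverse (of_nat u) * (of_nat u * (- (x ^ q)))) \<in> C"
    using u by (intro subring_uminus[OF C] subring_mult[OF C inv])
      (simp_all add: of_nat_eq_0_iff_char_dvd)
  hence "x ^ q \<in> C"
    using u by (simp add: of_nat_eq_0_iff_char_dvd flip: mult.assoc)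
  hence "k \<le> s" using notin[of s] by (force simp: q_def)
  thus ?thesis
    by (metis dvd_trans le_imp_power_dvd multiplicity_dvd s_def)
qed

text \<open>
  The minimal polynomial of \<open>x\<close> over \<open>C\<close> divides a power of \<open>X - x\<close>, so it is itself such a
  power, of exponent at least \<open>p ^ Suc k\<close>.
\<close>

lemma linear_char_power_dvd:
  fixes x :: "'a::field"
  assumes C: "is_subfield C" and p: "prime CHAR('a)"
    and inC: "x ^ (CHAR('a) ^ Suc k) \<in> C" and notin: "x ^ (CHAR('a) ^ k) \<notin> C"
    and f: "f \<in> polys_over C" "poly f x = 0"
  shows "[:-x, 1:] ^ (CHAR('a) ^ Suc k) dvd f"
proof -
  note R = subfield_subring[OF C]
  let ?N = "CHAR('a) ^ Suc k"
  define P where "P = (\<lambda>g. g \<in> polys_over C \<and> g \<noteq> 0 \<and> poly g x = 0)"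
  have L: "[:-x, 1:] ^ ?N \<in> polys_over C"
    unfolding linear_char_power[OF p]
    by (intro polys_over_diff[OF R] polys_over_monom[OF R] polys_over_const[OF R] inC subring_one[OF R])
  have "P ([:-x, 1:] ^ ?N)"
    using L p by (auto simp: P_def prime_gt_0_nat)
  then obtain g where g: "P g" and min: "\<And>h. P h \<Longrightarrow> Polynomial.degree g \<le> Polynomial.degree h"
    using ex_has_least_nat[of P _ Polynomial.degree] by blast
  \<comment> \<open>Division by \<open>g\<close>, carried out by hand so that all polynomials stay
    over \<open>C\<close>: the leading term is cancelled and the induction on the degree takes
    over.\<close>
  have gdvd: "g dvd h" if "h \<in> polys_over C" "poly h x = 0" for h
    using that
  proof (induction "Polynomial.degree h" arbitrary: h rule: less_induct)
    case less
    show ?case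
    proof (cases "h = 0")
      case False
      hence deg: "Polynomial.degree g \<le> Polynomial.degree h"
        using less.prems by (intro min) (simp add: P_def)
      define c where "c = Polynomial.lead_coeff h / Polynomial.lead_coeff g"
      define t where "t = Polynomial.monom c (Polynomial.degree h - Polynomial.degree g)"
      have "c \<in> C" unfolding c_def
        by (intro subfield_divide[OF C] polys_over_coeff) (use less.prems g in \<open>auto simp: P_def\<close>)
      have c0: "c \<noteq> 0" using g False by (simp add: c_def P_def)
      have tC: "h - t * g \<in> polys_over C"
        unfolding t_def using g less.prems \<open>c \<in> C\<close>
        by (intro polys_over_diff[OF R] polys_over_mult[OF R] polys_over_monom[OF R]) (auto simp: P_def)
      have t0: "poly (h - t * g) x = 0"
        using g less.prems by (simp add: P_def)
      have "g \<noteq> 0" using g by (simp add: P_def)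
      have dt: "Polynomial.degree (t * g) = Polynomial.degree h"
        using c0 \<open>g \<noteq> 0\<close> deg by (simp add: t_def degree_mult_eq degree_monom_eq monom_eq_0_iff)
      have lt: "Polynomial.lead_coeff (t * g) = Polynomial.lead_coeff h"
        using c0 \<open>g \<noteq> 0\<close> by (simp add: lead_coeff_mult) (simp add: t_def c_def degree_monom_eq)
      have "g dvd h - t * g"
      \<comment> \<open>Degree 0 is split off because no difference has smaller degree there; it
        cannot occur, as a nonzero constant has no root.\<close>
      proof (cases "Polynomial.degree h = 0")
        case True
        then obtain a where "h = [:a:]" by (metis degree_eq_zeroE)
        thus ?thesis using less.prems False by simp
      next
        case d0: False
        have "Polynomial.degree (h - t * g) < Polynomial.degree h"
          using d0 dt lt coeff_eq_0[of h] coeff_eq_0[of "t * g"]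
          by (metis (no_types, lifting) bot_nat_0.not_eq_extremum coeff_diff
              degree_diff_le eq_iff_diff_eq_0 le_neq_implies_less leading_coeff_0_iff order_refl degree_0)
        thus ?thesis using less.hyps tC t0 by blast
      qed
      hence "g dvd (h - t * g) + t * g" by (intro dvd_add) auto
      thus ?thesis by simp
    qed auto
  qed
  obtain e c where e: "c \<noteq> 0" "g = smult c ([:-x, 1:] ^ e)"
    using dvd_linear_power[OF gdvd[OF L]] p by (auto simp: prime_gt_0_nat)
  have "?N dvd e"
  proof (rule linear_power_over_imp_dvd[OF R p])
    show "e > 0" using g e by (cases e) (auto simp: P_def)
    have "smult (inverse c) g \<in> polys_over C"
    proof (intro polys_over_smult[OF R] subfield_inverse[OF C])
      \<comment> \<open>The power of X - x is monic, so \<open>c\<close> is the leading coefficient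
        of \<open>g\<close>; dividing by it shows that the power itself is over
        \<open>C\<close>.\<close>
      have "Polynomial.coeff g e = c" by (simp add: e coeff_linear_power)
      thus "c \<in> C" using g polys_over_coeff by (metis P_def)
    qed (use g in \<open>simp add: P_def\<close>)
    thus "[:-x, 1:] ^ e \<in> polys_over C" using e by simp
    show "x ^ (CHAR('a) ^ s) \<notin> C" if "s < Suc k" for s
    proof
      assume "x ^ (CHAR('a) ^ s) \<in> C"
      hence "(x ^ (CHAR('a) ^ s)) ^ (CHAR('a) ^ (k - s)) \<in> C"
        by (rule subring_power[OF R])
      thus False using notin that by (simp flip: power_mult power_add)
    qed
    show "inverse (of_nat n) \<in> C" for n
      using C R by (simp add: subfield_inverse subring_of_nat)
  qed
  moreover have "e > 0" using g e by (cases e) (auto simp: P_def)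
  ultimately have "[:-x, 1:] ^ ?N dvd g"
    using e by (simp add: dvd_imp_le le_imp_power_dvd dvd_smult)
  thus ?thesis using gdvd[OF f] by (rule dvd_trans)
qed

subsection \<open>Hasse derivatives\<close>

text \<open>The n-th derivative divided by n!, in a form that makes sense in characteristic p. Where
  \<open>i - n\<close> truncates, the binomial coefficient is 0.\<close>

definition hasse :: "nat \<Rightarrow> 'a::field Polynomial.poly \<Rightarrow> 'a Polynomial.poly" where
  "hasse n f = (\<Sum>i\<le>Polynomial.degree f.
     Polynomial.monom (of_nat (i choose n) * Polynomial.coeff f i) (i - n))"

lemma coeff_hasse: "Polynomial.coeff (hasse n f) l = of_nat ((l + n) choose n) * Polynomial.coeff f (l + n)"
proof -
  have "Polynomial.coeff (hasse n f) l = (\<Sum>i\<le>Polynomial.degree f.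
      if i = l + n then of_nat (i choose n) * Polynomial.coeff f i else 0)"
    unfolding hasse_def coeff_sum
    by (intro sum.cong refl) (auto simp: not_le binomial_eq_0)
  thus ?thesis by (simp add: sum.delta coeff_eq_0)
qed

lemma hasse_0: "hasse 0 f = f"
  by (rule poly_eqI) (simp add: coeff_hasse)

text \<open>Pascal's rule, with \<open>pCons a f\<close> read as a + X f. This recursion drives the
  inductions over \<open>f\<close>.\<close>

lemma hasse_pCons: "hasse (Suc n) (pCons a f) = pCons 0 (hasse (Suc n) f) + hasse n f"
proof (rule poly_eqI)
  fix l
  show "Polynomial.coeff (hasse (Suc n) (pCons a f)) l
      = Polynomial.coeff (pCons 0 (hasse (Suc n) f) + hasse n f) l"
    by (cases l) (simp_all add: coeff_hasse algebra_simps binomial_eq_0)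
qed

lemma hasse_hasse: "hasse i (hasse j f) = Polynomial.smult (of_nat ((i + j) choose i)) (hasse (i + j) f)"
proof (rule poly_eqI)
  fix l
  have "((l + i) choose i) * ((l + i + j) choose j) = ((i + j) choose i) * ((l + (i + j)) choose (i + j))"
    using choose_mult[of j "i + j" "l + i + j"] binomial_symmetric[of j "i + j"]
    by (simp add: add.assoc mult.commute)
  hence "(of_nat ((l + i) choose i) * of_nat ((l + i + j) choose j) :: 'a)
      = of_nat ((i + j) choose i) * of_nat ((l + (i + j)) choose (i + j))"
    by (simp flip: of_nat_mult)
  thus "Polynomial.coeff (hasse i (hasse j f)) l
      = Polynomial.coeff (Polynomial.smult (of_nat ((i + j) choose i)) (hasse (i + j) f)) l"
    by (simp add: coeff_hasse add.assoc flip: mult.assoc)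
qed

text \<open>Taylor expansion: \<open>[:x, 1:]\<close> is X + x. Rules for Hasse derivatives at
  \<open>x\<close> thus become rules for coefficients of f(X + x).\<close>

lemma poly_hasse: "poly (hasse n f) x = Polynomial.coeff (pcompose f [:x, 1:]) n"
proof (induction f arbitrary: n)
  case 0
  thus ?case by (simp add: hasse_def)
next
  case (pCons a f)
  show ?case
    by (cases n) (simp_all add: hasse_0 hasse_pCons pcompose_pCons poly_pcompose pCons.IH coeff_pCons
        flip: pCons.IH)
qed

lemma polys_over_hasse: "is_subring R \<Longrightarrow> f \<in> polys_over R \<Longrightarrow> hasse n f \<in> polys_over R"
  by (simp add: polys_over_def coeff_hasse subring_mult subring_of_nat)

lemma poly_hasse_diff: "poly (hasse n (f - g)) x = poly (hasse n f) x - poly (hasse n g) x"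
  by (simp add: poly_hasse pcompose_diff)

lemma poly_hasse_mult: "poly (hasse n (f * g)) x = (\<Sum>i\<le>n. poly (hasse i f) x * poly (hasse (n - i) g) x)"
  by (simp add: poly_hasse pcompose_mult coeff_mult)

lemma pcompose_power: "pcompose (f ^ n) g = pcompose f g ^ n"
  by (induction n) (simp_all add: pcompose_1 pcompose_mult)

text \<open>The shift by \<open>x\<close> turns a multiple of the N-th power of X - x into a
  multiple of the N-th power of X, whose coefficients below \<open>N\<close> vanish.\<close>

lemma poly_hasse_eq_0:
  fixes x :: "'a::field"
  assumes "[:-x, 1:] ^ N dvd f" "n < N"
  shows "poly (hasse n f) x = 0"
proof -
  obtain g where "f = [:-x, 1:] ^ N * g" using assms by (elim dvdE)
  hence "pcompose f [:x, 1:] = [:0, 1:] ^ N * pcompose g [:x, 1:]"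
    by (simp add: pcompose_mult pcompose_power pcompose_pCons)
  moreover have "[:0, 1:] ^ N = (Polynomial.monom 1 N :: 'a Polynomial.poly)"
    by (simp add: monom_altdef)
  ultimately show ?thesis
    using assms by (simp add: poly_hasse coeff_monom_mult)
qed

text \<open>In characteristic p > 0, the big field is C[x], purely inseparable over
  \<open>C\<close>; the two conditions on powers make its degree exactly p to the
  \<open>Suc k\<close>. Level \<open>k\<close> thus belongs to truncation at
  \<open>Suc k\<close>.\<close>

definition radical_generator :: "'a::field set \<Rightarrow> 'a \<Rightarrow> nat \<Rightarrow> bool" where
  "radical_generator C x k \<longleftrightarrow> is_subfield C \<and> adjoin C x = UNIV \<and>
     x ^ (CHAR('a) ^ Suc k) \<in> C \<and> x ^ (CHAR('a) ^ k) \<notin> C"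

text \<open>The difference \<open>f - g\<close> vanishes at \<open>x\<close>, hence is divisible by
  a power of X - x high enough to kill its low Hasse derivatives at \<open>x\<close>.\<close>

lemma poly_hasse_cong:
  assumes "prime CHAR('a::field)" "radical_generator C (x::'a) k" "f \<in> polys_over C" "g \<in> polys_over C"
    and "poly f x = poly g x" "n < CHAR('a) ^ Suc k"
  shows "poly (hasse n f) x = poly (hasse n g) x"
proof -
  have "[:-x, 1:] ^ (CHAR('a) ^ Suc k) dvd f - g"
    using assms by (intro linear_char_power_dvd[of C])
      (auto simp: radical_generator_def intro: polys_over_diff subfield_subring)
  thus ?thesis
    using poly_hasse_eq_0[OF _ assms(6), of x "f - g"] by (simp add: poly_hasse_diff)
qed

text \<open>
  By \<open>poly_hasse_cong\<close> the value \<open>D\<^sub>n (f(x)) = (hasse n f)(x)\<close> depends neither on \<open>f\<close> nor, as the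
  fields decrease, on the field of the chain over which \<open>f\<close> is taken.
\<close>

lemma Ga_derivation_of_chain:
  fixes x :: "'a::field" and C :: "nat \<Rightarrow> 'a set"
  assumes p: "prime CHAR('a)" and C: "\<And>k. radical_generator (C k) x (r + k)"
    and dec: "\<And>k. C (Suc k) \<subseteq> C k"
  shows "\<exists>D. Ga_derivation D \<and> (\<forall>k n f. f \<in> polys_over (C k) \<longrightarrow> n < CHAR('a) ^ Suc (r + k) \<longrightarrow>
           D n (poly f x) = poly (hasse n f) x)"
proof -
  define F where "F = (\<lambda>n z. SOME f. f \<in> polys_over (C n) \<and> poly f x = z)"
  define D where "D = (\<lambda>n z. poly (hasse n (F n z)) x)"
  have R: "is_subring (C k)" for k
    using C by (auto simp: radical_generator_def intro: subfield_subring)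
  have ex: "\<exists>f. f \<in> polys_over (C k) \<and> poly f x = z" for k z
    using C[of k] by (auto simp: radical_generator_def adjoin_def dest!: eqset_imp_iff[of _ _ z])
  have F: "F n z \<in> polys_over (C n)" "poly (F n z) x = z" for n z
    using someI_ex[OF ex[of n z]] by (simp_all add: F_def)
  \<comment> \<open>\<open>D n\<close> is computed over \<open>C n\<close>; this bound says that the
    degree of the big field over \<open>C n\<close> always exceeds \<open>n\<close>.\<close>
  have bound: "n < CHAR('a) ^ Suc (r + n)" for n
  proof -
    have "n < CHAR('a) ^ n" using p by (intro power_gt_expt) (simp add: prime_gt_Suc_0_nat)
    also have "\<dots> \<le> CHAR('a) ^ Suc (r + n)"
      using p by (intro power_increasing) (auto dest: prime_gt_0_nat)
    finally show ?thesis .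
  qed
  have mono: "polys_over (C l) \<subseteq> polys_over (C k)" if "k \<le> l" for k l
    using lift_Suc_antimono_le[of C, OF dec that] by (rule polys_over_mono)
  have D: "D n (poly f x) = poly (hasse n f) x"
    if f: "f \<in> polys_over (C k)" and n: "n < CHAR('a) ^ Suc (r + k)" for k n f
  \<comment> \<open>Two representatives of one element are compared over the larger of the fields
    \<open>C k\<close> and \<open>C n\<close>.\<close>
  proof (cases "k \<le> n")
    case True
    show ?thesis unfolding D_def
      using mono[OF True] F[of n "poly f x"] f n by (intro poly_hasse_cong[OF p C[of k]]) auto
  next
    case False
    show ?thesis unfolding D_def
      using mono[of n k] False F[of n "poly f x"] f bound by (intro poly_hasse_cong[OF p C[of n]]) auto
  qed
  have D': "D i (poly f x) = poly (hasse i f) x" if "f \<in> polys_over (C n)" "i \<le> n" for i n f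
    using that bound[of n] by (intro D[of f n]) auto
  have "Ga_derivation D"
    unfolding Ga_derivation_def
  proof (intro conjI allI)
    fix n
    show "Modules.additive (D n)"
    proof
      fix y z
      have "D n (poly (F n y + F n z) x) = D n (poly (F n y) x) + D n (poly (F n z) x)"
        using F R by (subst (1 2 3) D'[of _ n]) (auto simp: polys_over_add poly_hasse pcompose_add)
      thus "D n (y + z) = D n y + D n z" by (simp add: F)
    qed
  next
    show "D 0 = id"
      by (rule ext) (simp add: D_def hasse_0 F)
  next
    fix n y z
    have D_F: "poly (hasse i (F n w)) x = D i w" if "i \<le> n" for i w
      using D'[of "F n w" n i] F that by simp
    have "D n (poly (F n y * F n z) x) = poly (hasse n (F n y * F n z)) x"
      using F R by (intro D'[of _ n] polys_over_mult) auto
    thus "D n (y * z) = (\<Sum>i\<le>n. D i y * D (n - i) z)"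
      by (simp add: F poly_hasse_mult D_F)
  next
    fix i j z
    define f where "f = F (i + j) z"
    have f: "f \<in> polys_over (C (i + j))" "poly f x = z" using F by (simp_all add: f_def)
    have "D i (D j (poly f x)) = of_nat ((i + j) choose i) * D (i + j) (poly f x)"
      using f(1) R by (simp add: D'[of _ "i + j"] polys_over_hasse hasse_hasse)
    thus "D i (D j z) = of_nat ((i + j) choose i) * D (i + j) z" by (simp add: f)
  qed
  thus ?thesis using D by blast
qed

subsection \<open>Separability and the descending chain of fields\<close>

text \<open>Separability speaks of sets inside the algebraic closure. The embedding is injective, so
  a relation there pulls back along \<open>of_ac\<close>.\<close>

lemma lin_indep_over_to_ac:
  assumes "lin_indep_over M A"
  shows "lin_indep_over (to_ac ` M) (to_ac ` A)"
  unfolding lin_indep_over_def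
proof (intro allI impI, elim conjE)
  fix B c
  assume "finite B" "B \<subseteq> to_ac ` A" and c: "\<forall>b\<in>B. c b \<in> to_ac ` M" "(\<Sum>b\<in>B. c b * b) = 0"
  then obtain A' where A': "A' \<subseteq> A" "finite A'" and B: "B = to_ac ` A'"
    using finite_subset_image[of B to_ac A] by blast
  define c' where "c' = (\<lambda>a. of_ac (c (to_ac a)))"
  have cc': "c (to_ac a) = to_ac (c' a) \<and> c' a \<in> M" if "a \<in> A'" for a
    using c(1) that unfolding B c'_def by force
  have "to_ac (\<Sum>a\<in>A'. c' a * a) = (\<Sum>b\<in>B. c b * b)"
    unfolding B by (subst sum.reindex) (auto simp: to_ac_sum inj_on_def cc' intro!: sum.cong)
  hence "(\<Sum>a\<in>A'. c' a * a) = 0" using c(2) by simp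
  hence "\<forall>a\<in>A'. c' a = 0"
    using assms A' cc' unfolding lin_indep_over_def by blast
  thus "\<forall>b\<in>B. c b = 0" using cc' B by simp
qed

text \<open>With p-th roots \<open>r a\<close> of the coefficients, the relation is the p-th power
  of a relation among the elements of \<open>A\<close> over the perfect closure, which linear
  disjointness makes trivial.\<close>

lemma separable_power_lin_indep:
  fixes M :: "'a::field set"
  assumes sep: "separable_extension M" and p: "prime CHAR('a)"
    and A: "finite A" "lin_indep_over M A" and m: "\<And>a. a \<in> A \<Longrightarrow> m a \<in> M"
    and sum0: "(\<Sum>a\<in>A. m a * a ^ CHAR('a)) = 0"
  shows "\<forall>a\<in>A. m a = 0"
proof -
  have p0: "CHAR('a) > 0" using p by (rule prime_gt_0_nat)
  have "\<forall>a. \<exists>r. r ^ CHAR('a) = to_ac (m a)"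
    using nth_root_exists[OF p0] by blast
  then obtain r where r: "\<And>a. r a ^ CHAR('a) = to_ac (m a)" by metis
  have "linearly_disjoint (to_ac ` M) (range to_ac) (perfect_closure M)"
    using sep p0 by (simp add: separable_extension_def)
  hence indep: "lin_indep_over (perfect_closure M) (to_ac ` A)"
    using lin_indep_over_to_ac[OF A(2)] image_mono[of A UNIV to_ac]
    unfolding linearly_disjoint_def by blast
  have "(\<Sum>a\<in>A. r a * to_ac a) ^ CHAR('a) = to_ac (\<Sum>a\<in>A. m a * a ^ CHAR('a))"
    using p by (simp add: freshmans_dream_sum to_ac_sum power_mult_distrib r)
  hence "(\<Sum>a\<in>A. r a * to_ac a) = 0"
    using sum0 by simp
  hence sum0': "(\<Sum>b\<in>to_ac ` A. r (of_ac b) * b) = 0"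
    by (subst sum.reindex) (auto simp: inj_on_def)
  have "\<forall>b\<in>to_ac ` A. r (of_ac b) \<in> perfect_closure M"
    using m r by (auto simp: perfect_closure_def intro!: exI[of _ 1])
  hence "\<forall>b\<in>to_ac ` A. r (of_ac b) = 0"
    using A(1) sum0'
    by (intro indep[unfolded lin_indep_over_def, THEN spec[of _ "to_ac ` A"],
          THEN spec[of _ "\<lambda>b. r (of_ac b)"], THEN mp] conjI finite_imageI subset_refl)
  hence "\<forall>a\<in>A. r a = 0" by simp
  thus ?thesis using r p0 by (metis power_0_left to_ac_eq_0_iff neq0_conv)
qed

text \<open>
  A representation of \<open>y ^ p\<close> by fewest terms has \<open>A\<close> independent over \<open>M\<close>; then \<open>A\<close> together
  with \<open>y \<notin> C\<close> is independent too, and so are the \<open>p\<close>-th powers.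
\<close>

lemma separable_power_not_in_span:
  fixes M C :: "'a::field set"
  assumes sep: "separable_extension M" and M: "is_subfield M" and p: "prime CHAR('a)"
    and C: "is_subring C" and MC: "M \<subseteq> C" and y: "y \<notin> C"
    and "finite A" "A \<subseteq> C" "\<And>a. a \<in> A \<Longrightarrow> m a \<in> M"
  shows "(\<Sum>a\<in>A. m a * a ^ CHAR('a)) \<noteq> y ^ CHAR('a)"
  using assms(7-)
proof (induction "card A" arbitrary: A m rule: less_induct)
  case less
  note R = subfield_subring[OF M]
  have yA: "y \<notin> A" using y less.prems by blast
  show ?case
  proof (cases "lin_indep_over M (insert y A)")
    case True
    show ?thesis
    proof
      assume eq: "(\<Sum>a\<in>A. m a * a ^ CHAR('a)) = y ^ CHAR('a)"
      define m' where "m' = m(y := -1)"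
      have "(\<Sum>a\<in>A. m' a * a ^ CHAR('a)) = (\<Sum>a\<in>A. m a * a ^ CHAR('a))"
        using yA by (intro sum.cong) (auto simp: m'_def)
      hence "(\<Sum>a\<in>insert y A. m' a * a ^ CHAR('a)) = 0"
        using yA less.prems(1) eq by (simp add: m'_def)
      hence "\<forall>a\<in>insert y A. m' a = 0"
        using less.prems R by (intro separable_power_lin_indep[OF sep p _ True])
          (auto simp: m'_def subring_closed)
      thus False by (simp add: m'_def)
    qed
  next
    case False
    then obtain B c where B: "finite B" "B \<subseteq> insert y A" "\<forall>b\<in>B. c b \<in> M"
      "(\<Sum>b\<in>B. c b * b) = 0" "\<exists>b\<in>B. c b \<noteq> 0"
      unfolding lin_indep_over_def by blast
    have solve: "b = (\<Sum>a\<in>B - {b}. - (c a / c b) * a)" if "b \<in> B" "c b \<noteq> 0" for b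
    proof -
      have "c b * b = - (\<Sum>a\<in>B - {b}. c a * a)"
        using B(4) sum.remove[OF B(1) that(1), of "\<lambda>b. c b * b"] by (simp add: eq_neg_iff_add_eq_0)
      hence "b = - (\<Sum>a\<in>B - {b}. c a * a) / c b"
        using that by (simp add: field_simps)
      thus ?thesis by (simp add: sum_divide_distrib sum_negf)
    qed
    have coeff: "- (c a / c b) \<in> M" if "a \<in> B" "b \<in> B" for a b
      using that B R by (intro subring_uminus subfield_divide M) auto
    \<comment> \<open>Otherwise \<open>y\<close> would be a combination of elements of
      \<open>A\<close> over \<open>M\<close>, hence in \<open>C\<close>.\<close>
    have "\<not> (y \<in> B \<and> c y \<noteq> 0)"
    proof
      assume "y \<in> B \<and> c y \<noteq> 0"
      hence "y = (\<Sum>a\<in>B - {y}. - (c a / c y) * a)" using solve by blast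
      also have "\<dots> \<in> C"
        using coeff \<open>y \<in> B \<and> c y \<noteq> 0\<close> B(2) less.prems MC
        by (intro subring_sum[OF C] subring_mult[OF C]) blast+
      finally show False using y by blast
    qed
    then obtain b where b: "b \<in> B" "c b \<noteq> 0" "b \<in> A" using B(2,5) by blast
    \<comment> \<open>Coefficients of \<open>b\<close>, extended by 0 to all of
      \<open>A - {b}\<close>. The element \<open>y\<close> may occur in \<open>B\<close>, but only
      with coefficient 0.\<close>
    define n where "n = (\<lambda>a. if a \<in> B \<and> a \<noteq> y then - (c a / c b) else 0)"
    have nM: "n a \<in> M" for a
      using coeff b R by (simp add: n_def subring_zero)
    have "b = (\<Sum>a\<in>B - {b}. - (c a / c b) * a)" using solve b by blast
    also have "\<dots> = (\<Sum>a\<in>A - {b}. n a * a)"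
      using B(1,2) less.prems(1) yA \<open>\<not> (y \<in> B \<and> c y \<noteq> 0)\<close>
      by (intro sum.mono_neutral_cong) (auto simp: n_def)
    finally have b_eq: "b = (\<Sum>a\<in>A - {b}. n a * a)" .
    have "(\<Sum>a\<in>A. m a * a ^ CHAR('a)) = m b * b ^ CHAR('a) + (\<Sum>a\<in>A - {b}. m a * a ^ CHAR('a))"
      using less.prems(1) b(3) by (rule sum.remove)
    \<comment> \<open>Frobenius expresses the p-th power of \<open>b\<close> by those of the other
      elements, so its term is absorbed and one summand is saved.\<close>
    also have "b ^ CHAR('a) = (\<Sum>a\<in>A - {b}. n a ^ CHAR('a) * a ^ CHAR('a))"
      by (subst b_eq, subst freshmans_dream_sum) (simp_all add: p power_mult_distrib)
    finally have "(\<Sum>a\<in>A. m a * a ^ CHAR('a)) =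
        (\<Sum>a\<in>A - {b}. (m b * n a ^ CHAR('a) + m a) * a ^ CHAR('a))"
      by (simp add: sum_distrib_left algebra_simps sum.distrib)
    also have "\<dots> \<noteq> y ^ CHAR('a)"
      using less.prems b(3) nM R
      by (intro less.hyps card_Diff1_less) (auto intro!: subring_closed)
    finally show ?thesis .
  qed
qed

text \<open>
  For subfields \<open>M \<subseteq> C\<close>, this is the compositum of \<open>M\<close> and \<open>C\<^sup>p\<close>.
\<close>

inductive_set frobenius_span :: "'a::field set \<Rightarrow> 'a set \<Rightarrow> 'a set" for M C :: "'a set" where
  zero: "0 \<in> frobenius_span M C"
| step: "m \<in> M \<Longrightarrow> c \<in> C \<Longrightarrow> e \<in> frobenius_span M C \<Longrightarrow> m * c ^ CHAR('a) + e \<in> frobenius_span M C"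

text \<open>The same \<open>c\<close> may be used in several steps of the inductive definition;
  merging its coefficients gives a sum indexed by a set.\<close>

lemma frobenius_span_finite_sum:
  assumes "e \<in> frobenius_span M (C :: 'a::field set)" "is_subring M"
  shows "\<exists>A m. finite A \<and> A \<subseteq> C \<and> (\<forall>a\<in>A. m a \<in> M) \<and> e = (\<Sum>a\<in>A. m a * a ^ CHAR('a))"
  using assms(1)
proof induction
  case zero
  show ?case by (intro exI[of _ "{}"]) auto
next
  case (step m c e)
  then obtain A n where A: "finite A" "A \<subseteq> C" "\<forall>a\<in>A. n a \<in> M" "e = (\<Sum>a\<in>A. n a * a ^ CHAR('a))"
    by blast
  define n' where "n' = n(c := m + (if c \<in> A then n c else 0))"
  have "(\<Sum>a\<in>A - {c}. n' a * a ^ CHAR('a)) = (\<Sum>a\<in>A - {c}. n a * a ^ CHAR('a))"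
    by (intro sum.cong) (auto simp: n'_def)
  hence "(\<Sum>a\<in>insert c A. n' a * a ^ CHAR('a)) = m * c ^ CHAR('a) + e"
    using A(1) by (simp add: sum.insert_remove A(4) sum.remove[of A c] n'_def algebra_simps)
  moreover have "\<forall>a\<in>insert c A. n' a \<in> M"
    using step.hyps A(3) assms(2) by (auto simp: n'_def subring_closed)
  ultimately show ?case
    using A step.hyps by (intro exI[of _ "insert c A"] exI[of _ n']) auto
qed

lemma frobenius_span_add:
  assumes "e \<in> frobenius_span M C" "f \<in> frobenius_span M C"
  shows "e + f \<in> frobenius_span M C"
  using assms by induction (simp_all add: add.assoc frobenius_span.step)

lemma frobenius_span_mult:
  assumes M: "is_subring M" and C: "is_subring C"
    and "e \<in> frobenius_span M C" "f \<in> frobenius_span M C"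
  shows "e * f \<in> frobenius_span M (C :: 'a::field set)"
proof -
  have single: "m * c ^ CHAR('a) * f \<in> frobenius_span M C"
    if "f \<in> frobenius_span M C" "m \<in> M" "c \<in> C" for f m c
    using that(1)
  proof induction
    case (step n d e)
    have "(m * n) * (c * d) ^ CHAR('a) + m * c ^ CHAR('a) * e \<in> frobenius_span M C"
      using step that M C by (intro frobenius_span.step) (auto simp: subring_mult)
    thus ?case by (simp add: algebra_simps power_mult_distrib)
  qed (simp add: frobenius_span.zero)
  show ?thesis
    using assms(3) by induction (simp_all add: distrib_right assms single frobenius_span_add frobenius_span.zero)
qed

lemma frobenius_span_superset:
  assumes "is_subring M" "is_subring C"
  shows "M \<subseteq> frobenius_span M C" "c \<in> C \<Longrightarrow> c ^ CHAR('a) \<in> frobenius_span M (C :: 'a::field set)"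
  using frobenius_span.step[of _ M 1 C 0] frobenius_span.step[of 1 M c C 0] assms
  by (auto simp: subring_one frobenius_span.zero)

lemma frobenius_span_subset:
  assumes "is_subring C" "M \<subseteq> C"
  shows "frobenius_span M C \<subseteq> C"
proof
  fix e assume "e \<in> frobenius_span M C"
  thus "e \<in> C" by induction (use assms in \<open>auto simp: subring_closed\<close>)
qed

lemma frobenius_image_subfield:
  assumes "is_subfield C" and p: "prime CHAR('a::field)"
  shows "is_subfield ((\<lambda>c::'a. c ^ CHAR('a)) ` C)"
proof -
  have diff: "x ^ CHAR('a) - y ^ CHAR('a) = (x - y) ^ CHAR('a)" for x y :: 'a
    using freshmans_dream[OF p refl, of "x - y" y] by simp
  note R = subfield_subring[OF assms(1)]
  have "0 \<in> (\<lambda>c::'a. c ^ CHAR('a)) ` C"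
    by (rule image_eqI[of _ _ 0]) (use p R in \<open>auto simp: prime_gt_0_nat power_0_left subring_zero\<close>)
  moreover have "1 \<in> (\<lambda>c::'a. c ^ CHAR('a)) ` C"
    by (rule image_eqI[of _ _ 1]) (use R in \<open>auto simp: subring_one\<close>)
  ultimately show ?thesis
    using R assms(1) unfolding is_subfield_def
    by (auto simp: diff subring_closed simp flip: power_mult_distrib power_inverse)
qed

text \<open>The span is a ring, and p-th powers of its elements lie in the field of p-th powers of
  \<open>C\<close>, so \<open>subring_radical_subfield\<close> applies.\<close>

lemma frobenius_span_subfield:
  assumes M: "is_subfield M" and C: "is_subfield (C :: 'a::field set)" "M \<subseteq> C" and p: "prime CHAR('a)"
  shows "is_subfield (frobenius_span M C)"
proof (rule subring_radical_subfield[OF _ frobenius_image_subfield[OF C(1) p]])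
  note MR = subfield_subring[OF M] and CR = subfield_subring[OF C(1)]
  have "- e \<in> frobenius_span M C" if "e \<in> frobenius_span M C" for e
    using frobenius_span_mult[OF MR CR _ that, of "-1"] frobenius_span_superset(1)[OF MR CR]
      subring_uminus[OF MR subring_one[OF MR]] by auto
  hence "e - f \<in> frobenius_span M C" if "e \<in> frobenius_span M C" "f \<in> frobenius_span M C" for e f
    using frobenius_span_add[of e M C "- f"] that by simp
  thus "is_subring (frobenius_span M C)"
    unfolding is_subring_def
    using frobenius_span_mult[OF MR CR] frobenius_span_superset(1)[OF MR CR] subring_one[OF MR] by blast
  show "(\<lambda>c. c ^ CHAR('a)) ` C \<subseteq> frobenius_span M C"
    using frobenius_span_superset(2)[OF MR CR] by blast
  show "w ^ CHAR('a) \<in> (\<lambda>c. c ^ CHAR('a)) ` C" if "w \<in> frobenius_span M C" for w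
    using that frobenius_span_subset[OF CR C(2)] by blast
qed (use p in \<open>simp add: prime_gt_0_nat\<close>)

text \<open>Zorn's lemma: the union of a nonempty chain of subfields is a subfield, since any two of
  its elements lie in a common member.\<close>

lemma maximal_subfield_avoiding:
  assumes "is_subfield E" "E \<subseteq> C" "y \<notin> E"
  obtains F where "is_subfield F" "E \<subseteq> F" "F \<subseteq> C" "y \<notin> F"
    "\<And>G. is_subfield G \<Longrightarrow> F \<subseteq> G \<Longrightarrow> G \<subseteq> C \<Longrightarrow> y \<notin> G \<Longrightarrow> G = F"
proof -
  let ?S = "{F. is_subfield F \<and> E \<subseteq> F \<and> F \<subseteq> C \<and> y \<notin> F}"
  have "\<exists>F\<in>?S. \<forall>G\<in>?S. F \<subseteq> G \<longrightarrow> G = F"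
  proof (rule subset_Zorn_nonempty)
    fix \<C> assume ne: "\<C> \<noteq> {}" and ch: "subset.chain ?S \<C>"
    have sub: "is_subfield F \<and> E \<subseteq> F \<and> F \<subseteq> C \<and> y \<notin> F" if "F \<in> \<C>" for F
      using ch that by (auto simp: subset_chain_def)
    have tot: "F \<subseteq> G \<or> G \<subseteq> F" if "F \<in> \<C>" "G \<in> \<C>" for F G
      using ch that by (auto simp: subset_chain_def)
    have "is_subfield (\<Union>\<C>)"
      unfolding is_subfield_def
    proof (intro conjI ballI)
      obtain F where "F \<in> \<C>" using ne by blast
      thus "0 \<in> \<Union>\<C>" "1 \<in> \<Union>\<C>" using sub[of F] by (auto simp: is_subfield_def)
    next
      fix u v assume "u \<in> \<Union>\<C>" "v \<in> \<Union>\<C>"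
      then obtain F where "F \<in> \<C>" "u \<in> F" "v \<in> F" using tot by blast
      thus "u - v \<in> \<Union>\<C>" "u * v \<in> \<Union>\<C>" using sub[of F] by (auto simp: is_subfield_def)
    next
      fix u assume "u \<in> \<Union>\<C>"
      then obtain F where "F \<in> \<C>" "u \<in> F" by blast
      thus "inverse u \<in> \<Union>\<C>" using sub[of F] by (auto simp: is_subfield_def)
    qed
    thus "\<Union>\<C> \<in> ?S" using ne sub by blast
  qed (use assms in blast)
  then obtain F where F: "F \<in> ?S" and F_max: "\<forall>G\<in>?S. F \<subseteq> G \<longrightarrow> G = F"
    by (elim bexE)
  have max: "G = F" if "G \<in> ?S" "F \<subseteq> G" for G
    using bspec[OF F_max that(1)] that(2) by (rule mp)
  show ?thesis
  proof (rule that[of F])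
    fix G assume "is_subfield G" "F \<subseteq> G" "G \<subseteq> C" "y \<notin> G"
    thus "G = F" using F by (intro max) auto
  qed (use F in auto)
qed

text \<open>Reduction modulo the n-th power of X minus \<open>x ^ n\<close>: whenever multiplication
  by X creates a term of degree \<open>n\<close>, it is replaced by a constant.\<close>

lemma adjoin_bounded_degree:
  assumes R: "is_subring R" and n: "n > 0" "x ^ n \<in> R" and w: "w \<in> adjoin R x"
  shows "\<exists>f\<in>polys_over R. Polynomial.degree f < n \<and> w = poly f x"
proof -
  have "\<exists>g\<in>polys_over R. Polynomial.degree g < n \<and> poly f x = poly g x" if "f \<in> polys_over R" for f
    using that
  proof (induction f)
    case 0
    show ?case using n R by (intro bexI[of _ 0]) (auto simp: polys_over_0)
  next
    case (pCons a f)
    then obtain g where g: "g \<in> polys_over R" "Polynomial.degree g < n" "poly f x = poly g x"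
      by (auto simp: polys_over_pCons_iff)
    define c where "c = Polynomial.coeff g (n - 1)"
    define h where "h = pCons a g - Polynomial.monom c n + [:c * x ^ n:]"
    have "c \<in> R" using g by (simp add: c_def polys_over_coeff)
    hence "h \<in> polys_over R"
      unfolding h_def using pCons.prems g n
      by (intro polys_over_add[OF R] polys_over_diff[OF R] polys_over_monom[OF R] polys_over_const[OF R]
          subring_mult[OF R]) (auto simp: polys_over_pCons_iff)
    moreover have "Polynomial.coeff h i = 0" if "i \<ge> n" for i
      using that n(1) g(2) by (cases i) (auto simp: h_def c_def coeff_eq_0)
    hence "Polynomial.degree h < n"
      using n(1) by (metis degree_0 leading_coeff_0_iff not_le)
    moreover have "poly (pCons a f) x = poly h x"
      by (simp add: h_def g(3) poly_monom)
    ultimately show ?case by blast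
  qed
  thus ?thesis using w by (auto simp: adjoin_def)
qed

text \<open>
  For \<open>z\<close> in \<open>C\<close> but not in \<open>F[y]\<close>, maximality gives \<open>y = g(z)\<close> with \<open>g\<close> over \<open>F\<close> of degree below
  \<open>p\<close>; as \<open>z\<close> has degree \<open>p\<close> over \<open>F[y]\<close>, the polynomial \<open>g - y\<close> vanishes, so \<open>y\<close> lies in \<open>F\<close>.
\<close>

lemma maximal_subfield_adjoin:
  fixes F C :: "'a::field set"
  assumes p: "prime CHAR('a)" and F: "is_subfield F" "F \<subseteq> C" and C: "is_subring C" and y: "y \<in> C" "y \<notin> F"
    and pow: "\<And>c. c \<in> C \<Longrightarrow> c ^ CHAR('a) \<in> F"
    and max: "\<And>G. is_subfield G \<Longrightarrow> F \<subseteq> G \<Longrightarrow> G \<subseteq> C \<Longrightarrow> y \<notin> G \<Longrightarrow> G = F"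
  shows "C \<subseteq> adjoin F y"
proof (rule ccontr)
  assume "\<not> C \<subseteq> adjoin F y"
  then obtain z where z: "z \<in> C" "z \<notin> adjoin F y" by blast
  note R = subfield_subring[OF F(1)]
  have L: "is_subfield (adjoin F y)" using adjoin_subfield[OF F(1) p] pow y by blast
  have FL: "F \<subseteq> adjoin F y" using R by (rule subset_adjoin)
  have "y \<in> adjoin F z"
  proof (rule ccontr)
    assume "y \<notin> adjoin F z"
    hence "adjoin F z = F"
      using adjoin_subfield[OF F(1) p] pow z(1) subset_adjoin[OF R] adjoin_least[OF C F(2) z(1)]
      by (intro max) auto
    thus False using mem_adjoin[OF R, of z] FL z by blast
  qed
  then obtain g where g: "g \<in> polys_over F" "Polynomial.degree g < CHAR('a)" "y = poly g z"
    using adjoin_bounded_degree[OF R prime_gt_0_nat[OF p] pow[OF z(1)]] by blast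
  have "[:-z, 1:] ^ (CHAR('a) ^ Suc 0) dvd g - [:y:]"
  proof (rule linear_char_power_dvd[OF L p])
    show "z ^ (CHAR('a) ^ Suc 0) \<in> adjoin F y" using pow[OF z(1)] FL by auto
    show "g - [:y:] \<in> polys_over (adjoin F y)"
      using g(1) polys_over_mono[OF FL] mem_adjoin[OF R] subfield_subring[OF L]
      by (intro polys_over_diff polys_over_const) auto
  qed (use z g(3) in auto)
  moreover have "Polynomial.degree (g - [:y:]) < CHAR('a)"
    using g(2) degree_diff_less[of g "CHAR('a)" "[:y:]"] by auto
  ultimately have "g - [:y:] = 0"
    using dvd_imp_degree_le[of "[:-z, 1:] ^ CHAR('a)" "g - [:y:]"]
    by (auto simp: degree_linear_power)
  hence "y \<in> F" using polys_over_coeff[OF g(1), of 0] by simp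
  thus False using y by blast
qed

text \<open>Here \<open>y\<close> is the p-th power of an element outside \<open>C\<close>, so
  separability keeps it out of \<open>frobenius_span M C\<close>. For a maximal \<open>F\<close>
  avoiding \<open>y\<close>, the field \<open>C\<close> lies in F[y], hence in F[x].\<close>

lemma radical_generator_step:
  fixes x :: "'a::field"
  assumes sep: "separable_extension M" and M: "is_subfield M" and p: "prime CHAR('a)"
    and MC: "M \<subseteq> C" and C: "radical_generator C x k"
  shows "\<exists>F. M \<subseteq> F \<and> F \<subseteq> C \<and> radical_generator F x (Suc k)"
proof -
  define y where "y = x ^ (CHAR('a) ^ Suc k)"
  have Csub: "is_subfield C" and y: "y \<in> C" and x: "x ^ (CHAR('a) ^ k) \<notin> C" and gen: "adjoin C x = UNIV"
    using C by (auto simp: radical_generator_def y_def)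
  have y_eq: "y = (x ^ (CHAR('a) ^ k)) ^ CHAR('a)" by (simp add: y_def mult.commute flip: power_mult)
  note MR = subfield_subring[OF M] and CR = subfield_subring[OF Csub]
  let ?E = "frobenius_span M C"
  have "y \<notin> ?E"
  proof
    assume "y \<in> ?E"
    then obtain A m where "finite A" "A \<subseteq> C" "\<forall>a\<in>A. m a \<in> M" "y = (\<Sum>a\<in>A. m a * a ^ CHAR('a))"
      using frobenius_span_finite_sum[OF \<open>y \<in> ?E\<close> MR] by (elim exE conjE)
    thus False
      using separable_power_not_in_span[OF sep M p CR MC x, of A m] y_eq by auto
  qed
  then obtain F where F: "is_subfield F" "?E \<subseteq> F" "F \<subseteq> C" "y \<notin> F"
    "\<And>G. is_subfield G \<Longrightarrow> F \<subseteq> G \<Longrightarrow> G \<subseteq> C \<Longrightarrow> y \<notin> G \<Longrightarrow> G = F"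
    using maximal_subfield_avoiding[OF frobenius_span_subfield[OF M Csub MC p]
        frobenius_span_subset[OF CR MC]] by metis
  have pow: "c ^ CHAR('a) \<in> F" if "c \<in> C" for c
    using frobenius_span_superset(2)[OF MR CR that] F(2) by blast
  note FR = subfield_subring[OF F(1)]
  have S: "is_subring (adjoin F x)" using FR by (rule adjoin_subring)
  have "C \<subseteq> adjoin F y"
    by (rule maximal_subfield_adjoin[OF p F(1,3) CR y F(4) pow F(5)])
  also have "\<dots> \<subseteq> adjoin F x"
    unfolding y_def by (intro adjoin_least S subset_adjoin FR subring_power mem_adjoin)
  finally have "adjoin F x = UNIV"
    using adjoin_least[OF S _ mem_adjoin[OF FR]] gen by blast
  moreover have "x ^ (CHAR('a) ^ Suc (Suc k)) \<in> F"
    using pow[OF y] by (simp add: y_def mult.commute flip: power_mult)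
  ultimately have "radical_generator F x (Suc k)"
    using F(1,4) by (simp add: radical_generator_def y_def)
  thus ?thesis using F frobenius_span_superset(1)[OF MR CR] by blast
qed

subsection \<open>Truncated derivations\<close>

locale truncated_derivation =
  fixes d :: "nat \<Rightarrow> 'a::field \<Rightarrow> 'a" and m q :: nat
  assumes prime_char: "prime CHAR('a)"
    and q_eq: "q = CHAR('a) ^ m"
    and truncated: "truncated_Ga_derivation CHAR('a) m d"
begin

lemma d_additive: "n < q \<Longrightarrow> Modules.additive (d n)"
  using truncated by (simp add: truncated_Ga_derivation_def q_eq)

lemma d_0: "d 0 x = x"
  using truncated by (simp add: truncated_Ga_derivation_def q_eq)

lemma d_mult: "n < q \<Longrightarrow> d n (x * y) = (\<Sum>i\<le>n. d i x * d (n - i) y)"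
  using truncated by (simp add: truncated_Ga_derivation_def q_eq)

lemma d_d: "i < q \<Longrightarrow> j < q \<Longrightarrow>
    d i (d j x) = (if i + j < q then of_nat ((i + j) choose i) * d (i + j) x else 0)"
  using truncated by (simp add: truncated_Ga_derivation_def q_eq)

lemmas d_add = additive.add[OF d_additive]
lemmas d_zero = additive.zero[OF d_additive]
lemmas d_diff = additive.diff[OF d_additive]
lemmas d_minus = additive.minus[OF d_additive]

definition constants :: "'a set" where
  "constants = {x. \<forall>n. 0 < n \<and> n < q \<longrightarrow> d n x = 0}"

lemma d_constant: "c \<in> constants \<Longrightarrow> 0 < n \<Longrightarrow> n < q \<Longrightarrow> d n c = 0"
  by (simp add: constants_def)

lemma d_constant_mult:
  assumes "c \<in> constants" "n < q"
  shows "d n (c * x) = c * d n x"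
proof -
  have "d n (c * x) = (\<Sum>i\<le>n. if i = 0 then c * d n x else 0)"
    unfolding d_mult[OF assms(2)] using assms by (intro sum.cong) (auto simp: d_0 d_constant)
  thus ?thesis by simp
qed

text \<open>By induction only the two outer terms of the product rule for 1 * 1 survive, and
  \<open>d n 1\<close> equals its own double.\<close>

lemma d_one: "0 < n \<Longrightarrow> n < q \<Longrightarrow> d n 1 = 0"
proof (induction n rule: less_induct)
  case (less n)
  have "d n (1 * 1) = (\<Sum>i\<le>n. (if i = 0 then d n 1 else 0) + (if i = n then d n 1 else 0))"
    unfolding d_mult[OF less.prems(2)] using less by (intro sum.cong) (auto simp: d_0)
  hence "d n 1 = d n 1 + d n 1" by (simp add: sum.distrib)
  thus ?case by (metis add_cancel_right_right)
qed

lemma constants_subfield: "is_subfield constants"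
  unfolding is_subfield_def
proof (intro conjI ballI)
  fix x y assume xy: "x \<in> constants" "y \<in> constants"
  show "x - y \<in> constants" using xy by (simp add: constants_def d_diff)
  show "x * y \<in> constants" using xy by (simp add: constants_def d_constant_mult[OF xy(1)])
next
  fix x assume x: "x \<in> constants"
  show "inverse x \<in> constants"
  proof (cases "x = 0")
    case False
    have "d n (inverse x) = 0" if n: "0 < n" "n < q" for n
    proof -
      have "x * d n (inverse x) = d n (x * inverse x)"
        using d_constant_mult[OF x n(2)] by simp
      also have "\<dots> = 0" using False n by (simp add: d_one)
      finally show ?thesis using False by simp
    qed
    thus ?thesis by (simp add: constants_def)
  qed (use x in simp)
qed (simp_all add: constants_def d_zero d_one)

lemmas constants_subring = subfield_subring[OF constants_subfield]

text \<open>
  Modulo \<open>t ^ q\<close>, the power series \<open>\<phi> = \<Sum>\<^sub>n d\<^sub>n(a) t\<^sup>n\<close> is multiplicative in \<open>a\<close>. Expand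
  \<open>(\<phi> - a) ^ (q - 1) = d\<^sub>1(a) ^ (q - 1) * t ^ (q - 1) + \<dots>\<close>: the coefficient of \<open>t ^ (q - 1)\<close> is
  a combination of the values of \<open>d (q - 1)\<close> at powers of \<open>a\<close>.
\<close>

lemma top_nonzero:
  assumes a: "d 1 a \<noteq> 0"
  shows "\<exists>b. d (q - 1) b \<noteq> 0"
proof (rule ccontr)
  assume "\<not> ?thesis"
  hence zero: "d (q - 1) b = 0" for b by blast
  have q: "q > 0" using prime_char by (simp add: q_eq prime_gt_0_nat)
  \<comment> \<open>The terms \<open>d n\<close> with \<open>n \<ge> q\<close> are unconstrained;
    only coefficients below \<open>q\<close> are evaluated.\<close>
  define \<phi> where "\<phi> = Abs_fps (\<lambda>n. d n a)"
  have pow: "fps_nth (\<phi> ^ k) n = d n (a ^ k)" if "n < q" for k n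
    using that
  proof (induction k arbitrary: n)
    case 0
    thus ?case by (cases "n = 0") (auto simp: d_0 d_one)
  next
    case (Suc k)
    thus ?case
      by (simp add: fps_mult_nth d_mult \<phi>_def atLeast0AtMost)
  qed
  define v where "v = Abs_fps (\<lambda>n. d (Suc n) a)"
  have v_0: "fps_nth (v ^ k) 0 = d 1 a ^ k" for k
    by (induction k) (simp_all add: v_def)
  have "\<phi> + fps_const (- a) = fps_X * v"
    by (rule fps_ext) (auto simp: \<phi>_def v_def d_0)
  hence "(\<phi> + fps_const (- a)) ^ (q - 1) = fps_X ^ (q - 1) * v ^ (q - 1)"
    by (simp add: power_mult_distrib)
  hence "fps_nth ((\<phi> + fps_const (- a)) ^ (q - 1)) (q - 1) = d 1 a ^ (q - 1)"
    by (simp add: fps_X_power_mult_nth v_0)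
  also have "(\<phi> + fps_const (- a)) ^ (q - 1) =
      (\<Sum>k\<le>q - 1. \<phi> ^ k * fps_const (of_nat ((q - 1) choose k) * (- a) ^ (q - 1 - k)))"
    unfolding binomial_ring
    by (intro sum.cong) (simp_all add: fps_const_power fps_of_nat mult_ac flip: fps_const_mult)
  also have "fps_nth \<dots> (q - 1) = 0"
    using q zero by (simp add: fps_sum_nth pow)
  finally show False using a by simp
qed

text \<open>Scaling \<open>b\<close> by a constant makes its derivative of index
  \<open>q - 1\<close> equal to 1. Then \<open>d 1\<close> of \<open>d (q - 2) (c * b)\<close> is
  \<open>q - 1\<close>, that is -1, whence the sign in \<open>x\<close>; for \<open>i > 1\<close>
  the composite index reaches \<open>q\<close> and gives 0.\<close>

lemma exists_slice:
  assumes a: "d 1 a \<noteq> 0" and m: "m > 0"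
  obtains x where "d 1 x = 1" "\<And>i. 1 < i \<Longrightarrow> i < q \<Longrightarrow> d i x = 0"
proof -
  have q: "q > 1" unfolding q_eq by (rule one_less_power[OF prime_gt_1_nat[OF prime_char] m])
  obtain b where b: "d (q - 1) b \<noteq> 0" using top_nonzero[OF a] by blast
  define c where "c = inverse (d (q - 1) b)"
  have "d (q - 1) b \<in> constants"
    using q by (auto simp: constants_def d_d)
  hence c: "c \<in> constants"
    unfolding c_def by (rule subfield_inverse[OF constants_subfield])
  define x where "x = - d (q - 2) (c * b)"
  have top: "d (q - 1) (c * b) = 1"
    using b q by (simp add: d_constant_mult[OF c]) (simp add: c_def)
  have "of_nat q = (0 :: 'a)"
    using m by (simp add: q_eq of_nat_eq_0_iff_char_dvd)
  hence "of_nat (q - 1) = (-1 :: 'a)"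
    using q by (simp add: of_nat_diff)
  moreover have "1 + (q - 2) = q - 1" using q by simp
  ultimately have "d 1 x = 1"
    using q top by (simp add: x_def d_minus d_d)
  moreover have "d i x = 0" if "1 < i" "i < q" for i
    using that by (simp add: x_def d_minus d_d)
  ultimately show ?thesis by (rule that)
qed

section \<open>The big field as a purely inseparable extension of the constants, generated by a
  slice\<close>

context
  fixes x
  assumes d1x: "d 1 x = 1" and dix: "\<And>i. 1 < i \<Longrightarrow> i < q \<Longrightarrow> d i x = 0"
begin

lemma d_slice_mult:
  assumes "Suc n < q"
  shows "d (Suc n) (x * w) = x * d (Suc n) w + d n w"
proof -
  have "d (Suc n) (x * w) =
      (\<Sum>i\<le>Suc n. (if i = 0 then x * d (Suc n) w else 0) + (if i = 1 then d n w else 0))"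
    unfolding d_mult[OF assms]
  proof (intro sum.cong refl)
    fix i assume "i \<in> {..Suc n}"
    moreover consider "i = 0" | "i = 1" | "i > 1" by linarith
    ultimately show "d i x * d (Suc n - i) w =
        (if i = 0 then x * d (Suc n) w else 0) + (if i = 1 then d n w else 0)"
      using assms d1x by cases (auto simp: d_0 dix)
  qed
  thus ?thesis by (simp add: sum.distrib)
qed

text \<open>Both sides obey the same recursion: \<open>d_slice_mult\<close> matches
  \<open>hasse_pCons\<close>.\<close>

lemma d_poly_slice:
  assumes "f \<in> polys_over constants" "n < q"
  shows "d n (poly f x) = poly (hasse n f) x"
  using assms
proof (induction f arbitrary: n)
  case 0
  thus ?case by (simp add: hasse_def d_zero)
next
  case (pCons a f)
  show ?case
  proof (cases n)
    case 0
    thus ?thesis by (simp add: d_0 hasse_0)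
  next
    case (Suc k)
    thus ?thesis using pCons
      by (simp add: d_add d_slice_mult d_constant polys_over_pCons_iff hasse_pCons)
  qed
qed

lemma d_slice_power:
  assumes "n < q"
  shows "d n (x ^ k) = poly (hasse n (Polynomial.monom 1 k)) x"
  using d_poly_slice[OF polys_over_monom[OF constants_subring subring_one[OF constants_subring]] assms, of k]
  by (simp add: poly_monom)

lemma d_slice_power_ge:
  assumes "k \<le> n" "n < q"
  shows "d n (x ^ k) = (if n = k then 1 else 0)"
proof -
  have "hasse n (Polynomial.monom 1 k) = (if n = k then 1 else 0 :: 'a Polynomial.poly)"
    using assms(1) by (intro poly_eqI) (auto simp: coeff_hasse)
  thus ?thesis by (simp add: d_slice_power[OF assms(2)])
qed

text \<open>The q-th power of X + x has no terms of degree strictly between 0 and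
  \<open>q\<close>.\<close>

lemma slice_power_constant: "x ^ q \<in> constants"
proof -
  have "d n (x ^ q) = 0" if n: "0 < n" "n < q" for n
  proof -
    have "pcompose (Polynomial.monom 1 q) [:x, 1:] = [:x, 1:] ^ q"
      by (simp add: monom_altdef pcompose_power pcompose_pCons)
    also have "\<dots> = Polynomial.monom 1 q - [:(- x) ^ q:]"
      using linear_char_power[OF prime_char, of "- x" m] by (simp add: q_eq)
    finally have "Polynomial.coeff (pcompose (Polynomial.monom 1 q) [:x, 1:]) n = 0"
      using n by (simp add: coeff_pCons split: nat.splits)
    thus ?thesis by (simp add: d_slice_power[OF n(2)] poly_hasse)
  qed
  thus ?thesis by (simp add: constants_def)
qed

text \<open>Induction on a bound \<open>r\<close> for the indices of nonzero derivatives of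
  \<open>z\<close>: the derivative at the top index is a constant \<open>c\<close>, and subtracting
  \<open>c\<close> times that power of \<open>x\<close> lowers the bound.\<close>

lemma adjoin_constants_slice: "adjoin constants x = UNIV"
proof -
  note R = adjoin_subring[OF constants_subring, of x]
  have x: "x \<in> adjoin constants x" by (rule mem_adjoin[OF constants_subring])
  have "z \<in> adjoin constants x" if "\<And>i. r < i \<Longrightarrow> i < q \<Longrightarrow> d i z = 0" "r < q" for r z
    using that
  proof (induction r arbitrary: z)
    case 0
    hence "z \<in> constants" by (simp add: constants_def)
    thus ?case using subset_adjoin[OF constants_subring] by blast
  next
    case (Suc r)
    define c where "c = d (Suc r) z"
    have c: "c \<in> constants"
      using Suc.prems by (auto simp: constants_def c_def d_d)
    have "z - c * x ^ Suc r \<in> adjoin constants x"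
    proof (rule Suc.IH)
      fix i assume i: "r < i" "i < q"
      hence "d i (z - c * x ^ Suc r) = d i z - c * d i (x ^ Suc r)"
        by (simp only: d_diff d_constant_mult[OF c])
      also have "\<dots> = 0"
        using i Suc.prems(1)[of i] by (cases "i = Suc r") (simp_all add: d_slice_power_ge c_def del: power_Suc)
      finally show "d i (z - c * x ^ Suc r) = 0" .
    qed (use Suc.prems in simp)
    moreover have "c * x ^ Suc r \<in> adjoin constants x"
      using c subset_adjoin[OF constants_subring] x by (intro subring_mult[OF R] subring_power[OF R]) auto
    ultimately have "(z - c * x ^ Suc r) + c * x ^ Suc r \<in> adjoin constants x"
      by (rule subring_add[OF R])
    thus ?case by simp
  qed
  \<comment> \<open>For \<open>r = q - 1\<close> the vanishing condition is vacuous.\<close>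
  from this[of "q - 1"] show ?thesis
    using prime_char by (auto simp: q_eq prime_gt_0_nat)
qed

text \<open>The power of \<open>x\<close> with exponent p to the \<open>k\<close> is not a constant,
  because its derivative of that same index is 1.\<close>

lemma radical_generator_constants:
  assumes "m = Suc k"
  shows "radical_generator constants x k"
proof -
  have lt: "CHAR('a) ^ k < q"
    using prime_char assms by (simp add: q_eq prime_gt_Suc_0_nat prime_gt_0_nat)
  have "d (CHAR('a) ^ k) (x ^ (CHAR('a) ^ k)) = 1"
    using lt by (simp add: d_slice_power_ge)
  hence "x ^ (CHAR('a) ^ k) \<notin> constants"
    using lt prime_char d_constant[of _ "CHAR('a) ^ k"] by (auto simp: prime_gt_0_nat)
  thus ?thesis
    using slice_power_constant constants_subfield adjoin_constants_slice assms
    by (simp add: radical_generator_def q_eq)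
qed

lemma extension_of_slice:
  assumes sep: "separable_extension M" and M: "is_subfield M" "M \<subseteq> constants" and m: "m = Suc k"
  shows "\<exists>D. Ga_derivation D \<and> (\<forall>n z. 0 < n \<and> z \<in> M \<longrightarrow> D n z = 0) \<and> (\<forall>i<q. D i = d i)"
proof -
  \<comment> \<open>Dependent choice; the clause for \<open>n = 0\<close> makes the chain start at
    the constants, where \<open>D\<close> and \<open>d\<close> are both given by Hasse
    derivatives.\<close>
  have "\<exists>C. \<forall>n. (M \<subseteq> C n \<and> radical_generator (C n) x (k + n) \<and> (n = 0 \<longrightarrow> C n = constants))
      \<and> C (Suc n) \<subseteq> C n"
  proof (rule dependent_nat_choice)
    show "\<exists>C. M \<subseteq> C \<and> radical_generator C x (k + 0) \<and> (0 = (0::nat) \<longrightarrow> C = constants)"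
      using M(2) radical_generator_constants[OF m] by auto
    fix C n assume "M \<subseteq> C \<and> radical_generator C x (k + n) \<and> (n = 0 \<longrightarrow> C = constants)"
    thus "\<exists>F. (M \<subseteq> F \<and> radical_generator F x (k + Suc n) \<and> (Suc n = 0 \<longrightarrow> F = constants)) \<and> F \<subseteq> C"
      using radical_generator_step[OF sep M(1) prime_char, of C x "k + n"] by auto
  qed
  then obtain C where C: "\<And>n. M \<subseteq> C n" "\<And>n. radical_generator (C n) x (k + n)" "C 0 = constants"
    "\<And>n. C (Suc n) \<subseteq> C n" by metis
  obtain D where D: "Ga_derivation D" and D_poly: "\<And>l n f. f \<in> polys_over (C l) \<Longrightarrow>
      n < CHAR('a) ^ Suc (k + l) \<Longrightarrow> D n (poly f x) = poly (hasse n f) x"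
    using Ga_derivation_of_chain[OF prime_char C(2,4)] by metis
  have "D n z = 0" if n: "0 < n" and z: "z \<in> M" for n z
  proof -
    have "n < CHAR('a) ^ n"
      using prime_char by (intro power_gt_expt) (simp add: prime_gt_Suc_0_nat)
    also have "\<dots> \<le> CHAR('a) ^ Suc (k + n)"
      using prime_char by (intro power_increasing) (auto dest: prime_gt_0_nat)
    finally have "D n (poly [:z:] x) = poly (hasse n [:z:]) x"
      using C(1)[of n] C(2)[of n] z
      by (intro D_poly[of _ n] polys_over_const) (auto simp: radical_generator_def subfield_subring)
    thus ?thesis using n by (simp add: poly_hasse coeff_pCons split: nat.splits)
  qed
  moreover have "D i z = d i z" if i: "i < q" for i z
  proof -
    have "z \<in> adjoin constants x" using adjoin_constants_slice by simp
    then obtain f where "f \<in> polys_over constants" "z = poly f x" by (auto simp: adjoin_def)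
    thus ?thesis using D_poly[of f 0 i] C(3) m i d_poly_slice by (simp add: q_eq)
  qed
  ultimately show ?thesis using D by blast
qed

end

end

subsection \<open>Derivations supported on multiples of the characteristic\<close>

text \<open>Frobenius replaces the p-th power of 1 + X by 1 plus the p-th power of X. Comparing
  coefficients then yields the two special cases of Lucas's theorem that follow.\<close>

lemma linear_power_mult_char:
  assumes "prime CHAR('a::field)"
  shows "[:1, 1:] ^ (CHAR('a) * n) =
    (\<Sum>k\<le>n. Polynomial.monom (of_nat (n choose k) :: 'a) (CHAR('a) * k))"
proof -
  have "[:1, 1:] ^ CHAR('a) = ([:0, 1:] + 1 :: 'a Polynomial.poly) ^ CHAR('a)"
    by (simp add: one_pCons)
  also have "\<dots> = Polynomial.monom 1 CHAR('a) + 1"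
    by (subst freshmans_dream) (simp_all add: assms monom_altdef)
  finally have "[:1, 1:] ^ (CHAR('a) * n) = (Polynomial.monom 1 CHAR('a) + (1 :: 'a Polynomial.poly)) ^ n"
    by (simp only: power_mult)
  thus ?thesis
    by (simp add: binomial_ring monom_power of_nat_poly smult_monom)
qed

lemma of_nat_choose_mult_char:
  assumes "prime CHAR('a::field)"
  shows "(of_nat ((CHAR('a) * n) choose (CHAR('a) * k)) :: 'a) = of_nat (n choose k)"
proof -
  have "(of_nat ((CHAR('a) * n) choose (CHAR('a) * k)) :: 'a)
      = Polynomial.coeff ([:1, 1:] ^ (CHAR('a) * n)) (CHAR('a) * k)"
    using assms by (cases "k \<le> n")
      (simp_all add: coeff_linear_poly_power binomial_eq_0 coeff_eq_0 degree_linear_power prime_gt_0_nat)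
  also have "\<dots> = (\<Sum>j\<le>n. if j = k then of_nat (n choose j) else 0)"
    unfolding linear_power_mult_char[OF assms] coeff_sum
    using assms by (intro sum.cong) (auto simp: prime_gt_0_nat)
  also have "\<dots> = of_nat (n choose k)"
    by (simp add: binomial_eq_0)
  finally show ?thesis .
qed

lemma of_nat_choose_not_dvd_char:
  assumes "prime CHAR('a::field)" "\<not> CHAR('a) dvd i"
  shows "(of_nat ((CHAR('a) * n) choose i) :: 'a) = 0"
proof -
  have "(of_nat ((CHAR('a) * n) choose i) :: 'a) = Polynomial.coeff ([:1, 1:] ^ (CHAR('a) * n)) i"
    by (cases "i \<le> CHAR('a) * n")
      (simp_all add: coeff_linear_poly_power binomial_eq_0 coeff_eq_0 degree_linear_power)
  also have "\<dots> = 0"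
    unfolding linear_power_mult_char[OF assms(1)] coeff_sum
    using assms(2) by (intro sum.neutral) auto
  finally show ?thesis .
qed

lemma sum_multiples:
  fixes g :: "nat \<Rightarrow> 'b::comm_monoid_add"
  assumes "p > 0" "\<And>i. \<not> p dvd i \<Longrightarrow> g i = 0"
  shows "(\<Sum>i\<le>p * n. g i) = (\<Sum>i\<le>n. g (p * i))"
proof -
  have "(\<Sum>i\<le>p * n. g i) = (\<Sum>i\<in>(*) p ` {..n}. g i)"
  proof (intro sum.mono_neutral_right ballI)
    fix i assume i: "i \<in> {..p * n} - (*) p ` {..n}"
    have "\<not> p dvd i"
    proof
      assume "p dvd i"
      then obtain j where "i = p * j" by (elim dvdE)
      thus False using i assms(1) by auto
    qed
    thus "g i = 0" by (rule assms(2))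
  qed (use assms(1) in auto)
  also have "\<dots> = (\<Sum>i\<le>n. g (p * i))"
    using assms(1) by (subst sum.reindex) (auto simp: inj_on_def)
  finally show ?thesis .
qed

text \<open>In terms of the generating series of \<open>D\<close> in t, the substitution of the p-th
  power of t for t. It undoes the passage from \<open>d n\<close> to
  \<open>d (p * n)\<close>.\<close>

definition stretch :: "nat \<Rightarrow> (nat \<Rightarrow> 'a::zero \<Rightarrow> 'a) \<Rightarrow> nat \<Rightarrow> 'a \<Rightarrow> 'a" where
  "stretch p D n x = (if p dvd n then D (n div p) x else 0)"

lemma Ga_derivation_stretch:
  fixes D :: "nat \<Rightarrow> 'a::field \<Rightarrow> 'a"
  assumes p: "prime CHAR('a)" and D: "Ga_derivation D"
  shows "Ga_derivation (stretch CHAR('a) D)"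
proof -
  let ?p = "CHAR('a)"
  have p0: "?p > 0" using p by (rule prime_gt_0_nat)
  have D_mult: "D n (x * y) = (\<Sum>i\<le>n. D i x * D (n - i) y)" for n x y
    using D by (simp add: Ga_derivation_def)
  have D_D: "D i (D j x) = of_nat ((i + j) choose i) * D (i + j) x" for i j x
    using D by (simp add: Ga_derivation_def)
  have D_additive: "Modules.additive (D n)" for n
    using D by (simp add: Ga_derivation_def)
  have S_mult: "stretch ?p D (?p * n) x = D n x" for n x
    using p0 by (simp add: stretch_def)
  have S_0: "stretch ?p D n x = 0" if "\<not> ?p dvd n" for n x
    using that by (simp add: stretch_def)
  have S_zero: "stretch ?p D n 0 = 0" for n
    by (simp add: stretch_def additive.zero[OF D_additive])
  show ?thesis
    unfolding Ga_derivation_def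
  proof (intro conjI allI)
    fix n
    show "Modules.additive (stretch ?p D n)"
      by standard (simp add: stretch_def additive.add[OF D_additive])
  next
    show "stretch ?p D 0 = id"
      using D by (auto simp: stretch_def Ga_derivation_def)
  next
    fix n x y
    show "stretch ?p D n (x * y) = (\<Sum>i\<le>n. stretch ?p D i x * stretch ?p D (n - i) y)"
    proof (cases "?p dvd n")
      case True
      then obtain k where n: "n = ?p * k" by (elim dvdE)
      have "(\<Sum>i\<le>?p * k. stretch ?p D i x * stretch ?p D (?p * k - i) y)
          = (\<Sum>i\<le>k. stretch ?p D (?p * i) x * stretch ?p D (?p * k - ?p * i) y)"
        using p0 by (intro sum_multiples) (simp_all add: S_0)
      thus ?thesis
        by (simp add: n S_mult D_mult flip: diff_mult_distrib2)
    next
      case False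
      have "stretch ?p D i x * stretch ?p D (n - i) y = 0" if "i \<le> n" for i
        using False that dvd_add[of ?p i "n - i"] S_0[of i x] S_0[of "n - i" y] by auto
      hence "(\<Sum>i\<le>n. stretch ?p D i x * stretch ?p D (n - i) y) = 0"
        by (intro sum.neutral) auto
      thus ?thesis using False by (simp add: S_0)
    qed
  next
    fix i j x
    show "stretch ?p D i (stretch ?p D j x) = of_nat ((i + j) choose i) * stretch ?p D (i + j) x"
    proof (cases "?p dvd i + j")
      case False
      hence "\<not> ?p dvd i \<or> \<not> ?p dvd j" by auto
      thus ?thesis using False S_0 S_zero by auto
    next
      case sum: True
      show ?thesis
      proof (cases "?p dvd i")
        case True
        then obtain i' j' where "i = ?p * i'" "j = ?p * j'"
          using sum by (auto simp: dvd_add_right_iff elim!: dvdE)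
        thus ?thesis
          by (simp add: S_mult D_D of_nat_choose_mult_char[OF p] flip: distrib_left)
      next
        \<comment> \<open>The left side is 0 at its outer index, and on the right the binomial
          coefficient vanishes in characteristic p.\<close>
        case False
        obtain n where "i + j = ?p * n" using sum by (elim dvdE)
        thus ?thesis
          using False by (simp add: S_0 of_nat_choose_not_dvd_char[OF p])
      qed
    qed
  qed
qed

text \<open>The extension used in the base case of the induction, where only the identity at index 0
  is prescribed.\<close>

lemma Ga_derivation_trivial: "Ga_derivation (\<lambda>n x :: 'a::field. if n = 0 then x else 0)"
  unfolding Ga_derivation_def
proof (intro conjI allI)
  fix n :: nat
  show "Modules.additive (\<lambda>x::'a. if n = 0 then x else 0)" by standard simp
next
  fix n :: nat and x y :: 'a
  have "(\<Sum>i\<le>n. (if i = 0 then x else 0) * (if n - i = 0 then y else 0)) =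
      (\<Sum>i\<le>n. if i = 0 then (if n = 0 then x * y else 0) else 0)"
    by (intro sum.cong) auto
  thus "(if n = 0 then x * y else 0) = (\<Sum>i\<le>n. (if i = 0 then x else 0) * (if n - i = 0 then y else 0))"
    by simp
qed (auto simp: fun_eq_iff)

section \<open>Contraction of a truncated derivation whose first term is zero\<close>

context truncated_derivation
begin

text \<open>Iterativity gives \<open>d 1 (d (n - 1) x) = of_nat n * d n x\<close>, and
  \<open>n\<close> is invertible.\<close>

lemma d_not_dvd:
  assumes "d 1 = (\<lambda>_. 0)" "\<not> CHAR('a) dvd n" "n < q"
  shows "d n x = 0"
proof -
  have n: "n > 0" using assms(2) by (auto intro: gr0I)
  have "q > 1"
  proof (rule ccontr)
    assume "\<not> q > 1"
    thus False using n assms(3) by simp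
  qed
  hence "d 1 (d (n - 1) x) = of_nat n * d n x"
    using n assms(3) by (simp add: d_d)
  moreover have "of_nat n \<noteq> (0 :: 'a)"
    using assms(2) by (simp add: of_nat_eq_0_iff_char_dvd)
  ultimately show ?thesis using assms(1) by simp
qed

lemma truncated_derivation_contract:
  assumes d1: "d 1 = (\<lambda>_. 0)" and m: "m = Suc k"
  shows "truncated_derivation (\<lambda>n. d (CHAR('a) * n)) k (CHAR('a) ^ k)"
proof
  let ?p = "CHAR('a)"
  have p0: "?p > 0" using prime_char by (rule prime_gt_0_nat)
  have lt: "?p * n < q \<longleftrightarrow> n < ?p ^ k" for n
    using p0 by (simp add: q_eq m)
  show "truncated_Ga_derivation ?p k (\<lambda>n. d (?p * n))"
    unfolding truncated_Ga_derivation_def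
  proof (intro conjI allI impI)
    fix n assume "n < ?p ^ k"
    thus "Modules.additive (d (?p * n))" using lt by (intro d_additive) simp
  next
    show "d (?p * 0) = id" by (rule ext) (simp add: d_0)
  next
    fix n x y assume n: "n < ?p ^ k"
    \<comment> \<open>The guard \<open>i < q\<close> is there because \<open>sum_multiples\<close>
      wants vanishing at every non-multiple of p, while \<open>d_not_dvd\<close> covers only indices
      below \<open>q\<close>.\<close>
    have g: "(\<Sum>i\<le>?p * n. (if i < q then d i x else 0) * d (?p * n - i) y) =
        (\<Sum>i\<le>n. (if ?p * i < q then d (?p * i) x else 0) * d (?p * n - ?p * i) y)"
      using p0 d_not_dvd[OF d1] by (intro sum_multiples) auto
    have "d (?p * n) (x * y) = (\<Sum>i\<le>?p * n. (if i < q then d i x else 0) * d (?p * n - i) y)"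
      using n lt[of n] by (subst d_mult) (auto intro!: sum.cong)
    also have "\<dots> = (\<Sum>i\<le>n. d (?p * i) x * d (?p * (n - i)) y)"
      unfolding g using n lt by (intro sum.cong) (auto simp: diff_mult_distrib2)
    finally show "d (?p * n) (x * y) = (\<Sum>i\<le>n. d (?p * i) x * d (?p * (n - i)) y)" .
  next
    fix i j x assume "i < ?p ^ k" "j < ?p ^ k"
    hence "d (?p * i) (d (?p * j) x) = (if ?p * (i + j) < q then
        of_nat ((?p * (i + j)) choose (?p * i)) * d (?p * (i + j)) x else 0)"
      using lt by (subst d_d) (simp_all add: distrib_left)
    thus "d (?p * i) (d (?p * j) x) =
        (if i + j < ?p ^ k then of_nat ((i + j) choose i) * d (?p * (i + j)) x else 0)"
      by (simp only: lt of_nat_choose_mult_char[OF prime_char])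
  qed
qed (simp_all add: prime_char)

end

text \<open>The induction varies \<open>d\<close> and \<open>q\<close>, as contraction changes both.
  If \<open>d 1\<close> is zero, an extension of the contracted sequence is stretched back;
  otherwise a slice exists.\<close>

lemma truncated_derivation_extends:
  fixes M :: "'a::field set"
  assumes sep: "separable_extension M" and M: "is_subfield M"
    and "truncated_derivation d m q" "\<And>n x. 0 < n \<Longrightarrow> n < q \<Longrightarrow> x \<in> M \<Longrightarrow> d n x = 0"
  shows "\<exists>D. Ga_derivation D \<and> (\<forall>n x. 0 < n \<and> x \<in> M \<longrightarrow> D n x = 0) \<and> (\<forall>i<q. D i = d i)"
  using assms(3,4)
proof (induction m arbitrary: d q)
  case 0
  interpret truncated_derivation d 0 q by fact
  have "i < q \<longleftrightarrow> i = 0" for i by (simp add: q_eq)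
  thus ?case
    by (intro exI[of _ "\<lambda>n x. if n = 0 then x else 0"]) (auto simp: Ga_derivation_trivial fun_eq_iff d_0)
next
  case (Suc k)
  interpret truncated_derivation d "Suc k" q by fact
  let ?p = "CHAR('a)"
  have p0: "?p > 0" using prime_char by (rule prime_gt_0_nat)
  show ?case
  proof (cases "d 1 = (\<lambda>_. 0)")
    case True
    have lt: "?p * n < q \<longleftrightarrow> n < ?p ^ k" for n
      using p0 by (simp add: q_eq)
    obtain D where D: "Ga_derivation D" "\<forall>n x. 0 < n \<and> x \<in> M \<longrightarrow> D n x = 0"
      "\<forall>i<?p ^ k. D i = d (?p * i)"
      using Suc.IH[OF truncated_derivation_contract[OF True refl]] Suc.prems(2) p0 lt by auto
    have "stretch ?p D n x = 0" if "0 < n" "x \<in> M" for n x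
      using that D(2) p0 by (auto simp: stretch_def elim!: dvdE)
    moreover have "stretch ?p D i x = d i x" if i: "i < q" for i x
    proof (cases "?p dvd i")
      case True
      then obtain j where "i = ?p * j" by (elim dvdE)
      thus ?thesis using D(3) lt i p0 by (simp add: stretch_def)
    next
      case False
      thus ?thesis using d_not_dvd[OF True False i] by (simp add: stretch_def)
    qed
    ultimately show ?thesis
      using Ga_derivation_stretch[OF prime_char D(1)] by blast
  next
    case False
    then obtain a where "d 1 a \<noteq> 0" by auto
    then obtain x where x: "d 1 x = 1" "\<And>i. 1 < i \<Longrightarrow> i < q \<Longrightarrow> d i x = 0"
      using exists_slice by blast
    have "M \<subseteq> constants" using Suc.prems(2) by (auto simp: constants_def)
    thus ?thesis using extension_of_slice[OF x sep M _ refl] by blast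
  qed
qed

theorem theorem4p7:
  fixes M :: "'a::field set" and d :: "nat \<Rightarrow> 'a \<Rightarrow> 'a" and p m :: nat
  assumes "CHAR('a) = p" and "p > 0" and "m > 0"
    and "is_subfield M"
    and "separable_extension M"
    and "truncated_Ga_derivation p m d"
    and "\<forall>n x. 0 < n \<and> n < p ^ m \<and> x \<in> M \<longrightarrow> d n x = 0"
  shows "\<exists>D. Ga_derivation D \<and> (\<forall>n x. 0 < n \<and> x \<in> M \<longrightarrow> D n x = 0) \<and> (\<forall>i < p ^ m. D i = d i)"
proof -
  have "truncated_derivation d m (p ^ m)"
    using assms(1,2,6) by unfold_locales (auto intro: prime_CHAR_semidom)
  thus ?thesis
    using truncated_derivation_extends[OF assms(5,4)] assms(7) by blast
qed

end
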